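(* Let $A$ and $B$ be $C^*$-algebras and let $V$ be a Hilbert $A$-$B$-bimodule. Let $X:=[V]_{q.s.}$ be the completion of $V$ with respect to the quasi-strict topology, restricted to $V$. For a Cauchy net $\mathbf{x}=\{x_i\}$ in $V$ with respect to the quasi-strict topology, and for $a\in A$, $b\in B$, let $q_{\mathbf{x}}(a,b)\in V$ denote the vector to which the net $\{ax_ib\}$ converges. Then the correspondence $\mathbf{x}\mapsto q_{\mathbf{x}}$ is a linear isometric map from $X$ onto $QM(V)$. In other words, the quasi-multipliers of $V$ coincide with the completion of $V$ with respect to the quasi-strict topology.
   Context: A Hilbert $A$-$B$-bimodule $V$ is both a left Hilbert $A$-module, with $A$-valued inner product ${}_A\langle\cdot,\cdot\rangle$, and a right Hilbert $B$-module, with $B$-valued inner product $\langle\cdot,\cdot\rangle_B$, with commuting actions and such that ${}_A\langle x,y\rangle z=x\langle y,z\rangle_B$ for all $x,y,z\in V$. (The two norms on $V$ coming from the two inner products coincide.) The space of quasi-multipliers $QM(V)=\mathrm{Hom}_{A,B}(A\times B,V)$ is the set of bounded bilinear maps $q\colon A\times B\to V$ with $q(ca,bd)=c\,q(a,b)\,d$ for $a,c\in A$, $b,d\in B$, with norm $\|q\|=\sup\{\|q(a,b)\| : a\in A,\ b\in B,\ \|a\|\le1,\ \|b\|\le 1\}$. It is an $A$-$B$-bimodule via $(a\lhd q)(a',b')=q(a'a,b')$ and $(q\rhd b)(a',b')=q(a',bb')$. $V$ is isometrically embedded in $QM(V)$ by $\Gamma\colon V\to QM(V)$, $\Gamma(x)(a,b)=axb$,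 and is identified with its image. The quasi-strict topology (abbreviated q.s.) on $QM(V)$ is the locally convex topology defined by the family of seminorms $\nu_{a,b}(q)=\|a\lhd q\rhd b\|$, $a\in A$, $b\in B$. *)

theory Defs
  imports "HOL-Analysis.Analysis"
begin

section \<open>C*-algebras\<close>

class scaleC =
  fixes scaleC :: "complex \<Rightarrow> 'a \<Rightarrow> 'a"  (infixr "*\<^sub>C" 75)

class complex_normed_vector = real_normed_vector + scaleC +
  assumes scaleC_of_real: "complex_of_real r *\<^sub>C x = r *\<^sub>R x"
    and scaleC_add_right: "c *\<^sub>C (x + y) = c *\<^sub>C x + c *\<^sub>C y"
    and scaleC_add_left: "(c + d) *\<^sub>C x = c *\<^sub>C x + d *\<^sub>C x"
    and scaleC_scaleC: "c *\<^sub>C (d *\<^sub>C x) = (c * d) *\<^sub>C x"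
    and norm_scaleC: "norm (c *\<^sub>C x) = cmod c * norm x"

class complex_banach = complex_normed_vector + complete_space

text \<open>No unit is required.\<close>

class cstar_algebra = complex_banach + real_normed_algebra +
  fixes star :: "'a \<Rightarrow> 'a"
  assumes scaleC_mult_left: "(c *\<^sub>C a) * b = c *\<^sub>C (a * b)"
    and scaleC_mult_right: "a * (c *\<^sub>C b) = c *\<^sub>C (a * b)"
    and star_star: "star (star a) = a"
    and star_add: "star (a + b) = star a + star b"
    and star_scaleC: "star (c *\<^sub>C a) = cnj c *\<^sub>C star a"
    and star_mult: "star (a * b) = star b * star a"
    and cstar_identity: "norm (star a * a) = (norm a)\<^sup>2"

definition cstar_positive :: "'a::cstar_algebra \<Rightarrow> bool" where
  "cstar_positive a \<longleftrightarrow> (\<exists>c. a = star c * c)"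


section \<open>Hilbert bimodules\<close>

text \<open>The norm of the carrier type is the one given by the inner product (last axiom); definiteness
  of the inner product is a consequence of this, and completeness is part of the type class.\<close>

locale left_hilbert_module =
  fixes lact :: "'a::cstar_algebra \<Rightarrow> 'v::complex_banach \<Rightarrow> 'v"
    and linner :: "'v \<Rightarrow> 'v \<Rightarrow> 'a"
  assumes lact_add_left: "lact (a + b) x = lact a x + lact b x"
    and lact_add_right: "lact a (x + y) = lact a x + lact a y"
    and lact_scaleC_left: "lact (c *\<^sub>C a) x = c *\<^sub>C lact a x"
    and lact_scaleC_right: "lact a (c *\<^sub>C x) = c *\<^sub>C lact a x"
    and lact_mult: "lact (a * b) x = lact a (lact b x)"
    and linner_add_left: "linner (x + y) z = linner x z + linner y z"
    and linner_scaleC_left: "linner (c *\<^sub>C x) y = c *\<^sub>C linner x y"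
    and linner_lact: "linner (lact a x) y = a * linner x y"
    and linner_star: "star (linner x y) = linner y x"
    and linner_positive: "cstar_positive (linner x x)"
    and norm_linner: "norm x = sqrt (norm (linner x x))"

locale right_hilbert_module =
  fixes ract :: "'v::complex_banach \<Rightarrow> 'b::cstar_algebra \<Rightarrow> 'v"
    and rinner :: "'v \<Rightarrow> 'v \<Rightarrow> 'b"
  assumes ract_add_left: "ract (x + y) b = ract x b + ract y b"
    and ract_add_right: "ract x (b + d) = ract x b + ract x d"
    and ract_scaleC_left: "ract (c *\<^sub>C x) b = c *\<^sub>C ract x b"
    and ract_scaleC_right: "ract x (c *\<^sub>C b) = c *\<^sub>C ract x b"
    and ract_mult: "ract x (b * d) = ract (ract x b) d"
    and rinner_add_right: "rinner x (y + z) = rinner x y + rinner x z"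
    and rinner_scaleC_right: "rinner x (c *\<^sub>C y) = c *\<^sub>C rinner x y"
    and rinner_ract: "rinner x (ract y b) = rinner x y * b"
    and rinner_star: "star (rinner x y) = rinner y x"
    and rinner_positive: "cstar_positive (rinner x x)"
    and norm_rinner: "norm x = sqrt (norm (rinner x x))"

locale hilbert_bimodule =
  left_hilbert_module lact linner + right_hilbert_module ract rinner
  for lact :: "'a::cstar_algebra \<Rightarrow> 'v::complex_banach \<Rightarrow> 'v"
    and linner :: "'v \<Rightarrow> 'v \<Rightarrow> 'a"
    and ract :: "'v \<Rightarrow> 'b::cstar_algebra \<Rightarrow> 'v"
    and rinner :: "'v \<Rightarrow> 'v \<Rightarrow> 'b" +
  assumes actions_commute: "ract (lact a x) b = lact a (ract x b)"
    and linner_rinner: "lact (linner x y) z = ract x (rinner y z)"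


section \<open>Quasi-multipliers\<close>

definition QM ::
    "('a::cstar_algebra \<Rightarrow> 'v::complex_banach \<Rightarrow> 'v) \<Rightarrow> ('v \<Rightarrow> 'b::cstar_algebra \<Rightarrow> 'v)
      \<Rightarrow> ('a \<Rightarrow> 'b \<Rightarrow> 'v) set" where
  "QM lact ract = {q. bounded_bilinear q
     \<and> (\<forall>c a b. q (c *\<^sub>C a) b = c *\<^sub>C q a b)
     \<and> (\<forall>c a b. q a (c *\<^sub>C b) = c *\<^sub>C q a b)
     \<and> (\<forall>a c b d. q (c * a) (b * d) = ract (lact c (q a b)) d)}"

definition qm_norm :: "('a::cstar_algebra \<Rightarrow> 'b::cstar_algebra \<Rightarrow> 'v::complex_banach) \<Rightarrow> real" where
  "qm_norm q = Sup {norm (q a b) | a b. norm a \<le> 1 \<and> norm b \<le> 1}"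

definition qm_lact :: "'a::cstar_algebra \<Rightarrow> ('a \<Rightarrow> 'b \<Rightarrow> 'v) \<Rightarrow> 'a \<Rightarrow> 'b \<Rightarrow> 'v" where
  "qm_lact a q = (\<lambda>a' b'. q (a' * a) b')"

definition qm_ract :: "('a \<Rightarrow> 'b \<Rightarrow> 'v) \<Rightarrow> 'b::cstar_algebra \<Rightarrow> 'a \<Rightarrow> 'b \<Rightarrow> 'v" where
  "qm_ract q b = (\<lambda>a' b'. q a' (b * b'))"

definition qm_embed ::
    "('a::cstar_algebra \<Rightarrow> 'v::complex_banach \<Rightarrow> 'v) \<Rightarrow> ('v \<Rightarrow> 'b::cstar_algebra \<Rightarrow> 'v)
      \<Rightarrow> 'v \<Rightarrow> 'a \<Rightarrow> 'b \<Rightarrow> 'v" where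
  "qm_embed lact ract x = (\<lambda>a b. ract (lact a x) b)"

definition qs_seminorm ::
    "'a::cstar_algebra \<Rightarrow> 'b::cstar_algebra \<Rightarrow> ('a \<Rightarrow> 'b \<Rightarrow> 'v::complex_banach) \<Rightarrow> real" where
  "qs_seminorm a b q = qm_norm (qm_ract (qm_lact a q) b)"


section \<open>Nets\<close>

text \<open>Only the restriction of \<open>le\<close> and \<open>pt\<close> to the index set \<open>idx\<close> is relevant.\<close>

datatype ('i, 'v) net = Net (idx: "'i set") (le: "'i \<Rightarrow> 'i \<Rightarrow> bool") (pt: "'i \<Rightarrow> 'v")

definition directed_net :: "('i, 'v) net \<Rightarrow> bool" where
  "directed_net x \<longleftrightarrow> idx x \<noteq> {}
     \<and> (\<forall>i\<in>idx x. le x i i)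
     \<and> (\<forall>i\<in>idx x. \<forall>j\<in>idx x. \<forall>k\<in>idx x. le x i j \<longrightarrow> le x j k \<longrightarrow> le x i k)
     \<and> (\<forall>i\<in>idx x. \<forall>j\<in>idx x. \<exists>k\<in>idx x. le x i k \<and> le x j k)"

text \<open>The filter of tails, so that \<open>(f \<longlongrightarrow> l) (tails x)\<close> is convergence along the directed set of \<open>x\<close>.\<close>

definition tails :: "('i, 'v) net \<Rightarrow> 'i filter" where
  "tails x = (INF i\<in>idx x. principal {j \<in> idx x. le x i j})"

definition net_const :: "'v \<Rightarrow> (unit, 'v) net" where
  "net_const v = Net UNIV (\<lambda>_ _. True) (\<lambda>_. v)"

definition net_add :: "('i, 'v::plus) net \<Rightarrow> ('j, 'v) net \<Rightarrow> ('i \<times> 'j, 'v) net" where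
  "net_add x y = Net (idx x \<times> idx y) (\<lambda>(i, j) (i', j'). le x i i' \<and> le y j j')
     (\<lambda>(i, j). pt x i + pt y j)"

definition net_scaleC :: "complex \<Rightarrow> ('i, 'v::scaleC) net \<Rightarrow> ('i, 'v) net" where
  "net_scaleC c x = Net (idx x) (le x) (\<lambda>i. c *\<^sub>C pt x i)"


section \<open>The quasi-strict completion\<close>

definition qs_cauchy ::
    "('a::cstar_algebra \<Rightarrow> 'v::complex_banach \<Rightarrow> 'v) \<Rightarrow> ('v \<Rightarrow> 'b::cstar_algebra \<Rightarrow> 'v)
      \<Rightarrow> ('i, 'v) net \<Rightarrow> bool" where
  "qs_cauchy lact ract x \<longleftrightarrow> directed_net x \<and>
     (\<forall>a b. \<forall>e>0. \<exists>k\<in>idx x. \<forall>i\<in>idx x. \<forall>j\<in>idx x. le x k i \<longrightarrow> le x k j \<longrightarrow>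
        qs_seminorm a b (qm_embed lact ract (pt x i - pt x j)) < e)"

definition qs_equiv ::
    "('a::cstar_algebra \<Rightarrow> 'v::complex_banach \<Rightarrow> 'v) \<Rightarrow> ('v \<Rightarrow> 'b::cstar_algebra \<Rightarrow> 'v)
      \<Rightarrow> ('i, 'v) net \<Rightarrow> ('j, 'v) net \<Rightarrow> bool" where
  "qs_equiv lact ract x y \<longleftrightarrow>
     (\<forall>a b. \<forall>e>0. \<exists>k\<in>idx x. \<exists>l\<in>idx y. \<forall>i\<in>idx x. \<forall>j\<in>idx y. le x k i \<longrightarrow> le y l j \<longrightarrow>
        qs_seminorm a b (qm_embed lact ract (pt x i - pt y j)) < e)"

text \<open>The completion is the set of equivalence classes of Cauchy nets. As there is no set of all nets,
  the members of a class are indexed by directed sets in the type \<open>'v \<times> 'v set\<close>. No Cauchy net is lost: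
  a net \<open>x\<close> over an arbitrary index type is equivalent to the net \<open>(v, S) \<mapsto> v\<close> on
  the pairs with \<open>v \<in> S\<close> and \<open>x\<close> eventually in \<open>S\<close>, directed by reverse inclusion of the sets \<open>S\<close>.
  Accordingly, the class of a net is defined for every index type.\<close>

definition qs_class ::
    "('a::cstar_algebra \<Rightarrow> 'v::complex_banach \<Rightarrow> 'v) \<Rightarrow> ('v \<Rightarrow> 'b::cstar_algebra \<Rightarrow> 'v)
      \<Rightarrow> ('i, 'v) net \<Rightarrow> ('v \<times> 'v set, 'v) net set" where
  "qs_class lact ract x = {y. qs_cauchy lact ract y \<and> qs_equiv lact ract x y}"

definition qs_completion ::
    "('a::cstar_algebra \<Rightarrow> 'v::complex_banach \<Rightarrow> 'v) \<Rightarrow> ('v \<Rightarrow> 'b::cstar_algebra \<Rightarrow> 'v)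
      \<Rightarrow> ('v \<times> 'v set, 'v) net set set" where
  "qs_completion lact ract =
     {qs_class lact ract x | x :: ('v \<times> 'v set, 'v) net. qs_cauchy lact ract x}"

text \<open>Operations on classes. The unions are over representatives; all members of these unions agree.\<close>

definition qsc_add ::
    "('a::cstar_algebra \<Rightarrow> 'v::complex_banach \<Rightarrow> 'v) \<Rightarrow> ('v \<Rightarrow> 'b::cstar_algebra \<Rightarrow> 'v)
      \<Rightarrow> ('v \<times> 'v set, 'v) net set \<Rightarrow> ('v \<times> 'v set, 'v) net set \<Rightarrow> ('v \<times> 'v set, 'v) net set" where
  "qsc_add lact ract \<xi> \<eta> = (\<Union>x\<in>\<xi>. \<Union>y\<in>\<eta>. qs_class lact ract (net_add x y))"

definition qsc_scaleC ::
    "('a::cstar_algebra \<Rightarrow> 'v::complex_banach \<Rightarrow> 'v) \<Rightarrow> ('v \<Rightarrow> 'b::cstar_algebra \<Rightarrow> 'v)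
      \<Rightarrow> complex \<Rightarrow> ('v \<times> 'v set, 'v) net set \<Rightarrow> ('v \<times> 'v set, 'v) net set" where
  "qsc_scaleC lact ract c \<xi> = (\<Union>x\<in>\<xi>. qs_class lact ract (net_scaleC c x))"

text \<open>The continuous extensions of the quasi-strict seminorms from \<open>V\<close> to its completion.\<close>

definition qsc_seminorm ::
    "('a::cstar_algebra \<Rightarrow> 'v::complex_banach \<Rightarrow> 'v) \<Rightarrow> ('v \<Rightarrow> 'b::cstar_algebra \<Rightarrow> 'v)
      \<Rightarrow> 'a \<Rightarrow> 'b \<Rightarrow> ('v \<times> 'v set, 'v) net set \<Rightarrow> real" where
  "qsc_seminorm lact ract a b \<xi> =
     (let x = SOME x. x \<in> \<xi> in Lim (tails x) (\<lambda>i. qs_seminorm a b (qm_embed lact ract (pt x i))))"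

text \<open>The norm of the completion: on \<open>V\<close>, and on quasi-multipliers, the norm is the supremum of the
  quasi-strict seminorms over the unit balls, and this formula extends it to the completion.\<close>

definition qsc_norm ::
    "('a::cstar_algebra \<Rightarrow> 'v::complex_banach \<Rightarrow> 'v) \<Rightarrow> ('v \<Rightarrow> 'b::cstar_algebra \<Rightarrow> 'v)
      \<Rightarrow> ('v \<times> 'v set, 'v) net set \<Rightarrow> real" where
  "qsc_norm lact ract \<xi> = Sup {qsc_seminorm lact ract a b \<xi> | a b. norm a \<le> 1 \<and> norm b \<le> 1}"

definition q_lim ::
    "('a::cstar_algebra \<Rightarrow> 'v::complex_banach \<Rightarrow> 'v) \<Rightarrow> ('v \<Rightarrow> 'b::cstar_algebra \<Rightarrow> 'v)
      \<Rightarrow> ('i, 'v) net \<Rightarrow> 'a \<Rightarrow> 'b \<Rightarrow> 'v" where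
  "q_lim lact ract x = (\<lambda>a b. Lim (tails x) (\<lambda>i. ract (lact a (pt x i)) b))"

definition q_map ::
    "('a::cstar_algebra \<Rightarrow> 'v::complex_banach \<Rightarrow> 'v) \<Rightarrow> ('v \<Rightarrow> 'b::cstar_algebra \<Rightarrow> 'v)
      \<Rightarrow> ('v \<times> 'v set, 'v) net set \<Rightarrow> 'a \<Rightarrow> 'b \<Rightarrow> 'v" where
  "q_map lact ract \<xi> = q_lim lact ract (SOME x. x \<in> \<xi>)"

end

theory Submission
  imports Defs
begin

text \<open>
  The key notion is that of a net \<open>x\<close> in \<open>V\<close> converging to a map \<open>q\<close> on \<open>A \<times> B\<close>, in the sense that
  \<open>a x\<^sub>i b \<rightarrow> q(a,b)\<close> for all \<open>a\<close> and \<open>b\<close>. A quasi-multiplier satisfies \<open>\<nu>\<^sub>a\<^sub>,\<^sub>b(q) = \<parallel>q(a,b)\<parallel>\<close>, because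
  every vector \<open>y\<close> attains its norm: up to a scalar, \<open>\<langle>y,y\<rangle>\<close> is an element of norm at most 1 whose action on
  \<open>y\<close> preserves the norm. Hence the quasi-strict Cauchy nets are those for which all the nets
  \<open>a x\<^sub>i b\<close> are Cauchy, that is, since \<open>V\<close> is complete, those which have a limit \<open>q\<close>, and two of them are
  equivalent if and only if their limits are equal. So the completion is in bijection with the set of all
  limits \<open>q\<close>, and the linear structure and the seminorms are carried along by continuity. It
  remains to see that this set is \<open>QM(V)\<close>. This has two parts.

  A limit \<open>q\<close> is clearly bilinear and a bimodule map, but it is not clear that it is bounded, because a
  Cauchy net need not be bounded. Boundedness is automatic, however, for every bimodule map \<open>q\<close>:
  if it failed, there would be \<open>a\<^sub>n\<close> and \<open>b\<^sub>n\<close> of norm at most \<open>2\<^bsup>-n\<^esup>\<close> with \<open>\<parallel>q(a\<^sub>n,b\<^sub>n)\<parallel> > n\<close>. By Cohen's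
  factorization theorem such sequences have a common factor, \<open>a\<^sub>n = u\<^sub>n d\<close> and \<open>b\<^sub>n = f v\<^sub>n\<close> with bounded
  \<open>u\<^sub>n\<close> and \<open>v\<^sub>n\<close>, so that \<open>q(a\<^sub>n,b\<^sub>n) = u\<^sub>n q(d,f) v\<^sub>n\<close> is bounded, a contradiction.

  Conversely, given \<open>q \<in> QM(V)\<close>, take \<open>e\<close> and \<open>f\<close> from approximate units of \<open>A\<close> and \<open>B\<close>. Then
  \<open>a q(e,f) b = q(ae,fb)\<close> is close to \<open>q(a,b)\<close>, for finitely many \<open>a\<close> and \<open>b\<close> at once, so \<open>q\<close> is the
  quasi-strict limit of a net in \<open>V\<close>.

  Both parts rest on approximate units, which are constructed without spectral theory: for a
  hermitian \<open>h\<close> with \<open>\<parallel>h\<parallel>\<^sup>2 \<le> 3/4\<close>, the contraction principle gives the square root \<open>s\<close> of \<open>1 - h\<^sup>2\<close>. As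
  \<open>h \<plusminus> i s\<close> are unitary, \<open>s\<close> and \<open>1 - h\<^sup>2\<close> have norm at most 1. This bounds the resolvent \<open>1 - e = (1 + n h\<^sup>2)\<^sup>-\<^sup>1\<close>,
  and \<open>a (1 - e)\<close> is small if \<open>h = a\<^sup>* a\<close> and \<open>n\<close> is large. As no unit is assumed, \<open>1\<close>
  stands for the identity map throughout, and \<open>x (1 - e)\<close> is written as \<open>x - x * e\<close>.
\<close>

section \<open>Elementary facts on C*-algebras\<close>

lemma norm_star [simp]: "norm (star a) = norm (a::'a::cstar_algebra)"
proof -
  have le: "norm b \<le> norm (star b)" for b :: 'a
  proof (cases "b = 0")
    case False
    have "(norm b)\<^sup>2 \<le> norm (star b) * norm b"
      using norm_mult_ineq[of "star b" b] by (simp add: cstar_identity)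
    with False show ?thesis by (simp add: power2_eq_square)
  qed simp
  from le[of a] le[of "star a"] show ?thesis by (simp add: star_star)
qed

lemma cstar_identity': "norm (a * star a) = (norm (a::'a::cstar_algebra))\<^sup>2"
  using cstar_identity[of "star a"] by (simp add: star_star)

lemma bounded_linear_scaleC: "bounded_linear (\<lambda>x. c *\<^sub>C (x::'a::complex_normed_vector))"
proof (rule bounded_linear_intro[where K = "cmod c"])
  show "c *\<^sub>C (r *\<^sub>R x) = r *\<^sub>R (c *\<^sub>C x)" for r and x :: 'a
    by (simp add: scaleC_of_real[symmetric] scaleC_scaleC mult.commute)
qed (simp_all add: scaleC_add_right norm_scaleC)

lemma scaleC_minus_one: "(- 1) *\<^sub>C x = - (x::'a::complex_normed_vector)"
  using scaleC_of_real[of "-1" x] by simp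

lemma bounded_linear_star: "bounded_linear (star :: 'a::cstar_algebra \<Rightarrow> 'a)"
proof (rule bounded_linear_intro[where K = 1])
  show "star (r *\<^sub>R x) = r *\<^sub>R star x" for r and x :: 'a
    by (simp add: scaleC_of_real[symmetric] star_scaleC)
qed (simp_all add: star_add)

lemmas star_diff = linear_diff[OF bounded_linear.linear[OF bounded_linear_star]]
lemmas star_scaleR = linear_cmul[OF bounded_linear.linear[OF bounded_linear_star]]

section \<open>Approximate units\<close>

instance complex_banach \<subseteq> banach ..

text \<open>
  The equation \<open>(1 - r)\<^sup>2 = 1 - h\<^sup>2\<close> is the fixed point equation \<open>r = (h\<^sup>2 + r\<^sup>2)/2\<close>. On the ball of radius \<open>1/2\<close>
  its right-hand side is a contraction; the bound \<open>3/4\<close> on \<open>\<parallel>h\<parallel>\<^sup>2\<close> is what makes this ball invariant. The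
  iteration stays among the hermitian elements that commute with \<open>h\<close>, and these form a closed set.
\<close>

lemma hermitian_sqrt_one_minus_square:
  fixes h :: "'a::cstar_algebra"
  assumes h: "star h = h" and small: "(norm h)\<^sup>2 \<le> 3/4"
  obtains r where "star r = r" "h * r = r * h" "r + r - r * r = h * h"
proof -
  define f where "f r = (1/2) *\<^sub>R (h * h + r * r)" for r
  define C where "C = {r. norm r \<le> 1/2} \<inter> {r. star r = r} \<inter> {r. h * r = r * h}"
  have "closed C"
    unfolding C_def
    by (intro closed_Int closed_Collect_le closed_Collect_eq continuous_intros
        linear_continuous_on[OF bounded_linear_star])
  then have "complete C" by (simp add: complete_eq_closed)
  moreover have "C \<noteq> {}"
    using linear_0[OF bounded_linear.linear[OF bounded_linear_star]]
    by (auto simp: C_def intro!: exI[of _ 0] simp: set_eq_iff)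
  moreover have "f ` C \<subseteq> C"
  proof safe
    fix r assume r: "r \<in> C"
    have "norm (h * h) \<le> 3/4"
      using norm_mult_ineq[of h h] small by (simp add: power2_eq_square)
    moreover have "norm (r * r) \<le> 1/2 * (1/2)"
      using r by (intro order_trans[OF norm_mult_ineq] mult_mono) (auto simp: C_def)
    ultimately have "norm (f r) \<le> 1/2"
      using norm_triangle_ineq[of "h * h" "r * r"] by (simp add: f_def)
    moreover have "star (f r) = f r"
      using r h by (simp add: f_def C_def star_scaleR star_add star_mult)
    moreover have "h * f r = f r * h"
    proof -
      have hr: "h * r = r * h" using r by (simp add: C_def)
      then have "h * (r * r) = r * r * h" by (metis mult.assoc)
      then show ?thesis by (simp add: f_def algebra_simps)
    qed
    ultimately show "f r \<in> C" by (simp add: C_def)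
  qed
  moreover have "dist (f r) (f r') \<le> 1/2 * dist r r'" if "r \<in> C" "r' \<in> C" for r r'
  proof -
    have "norm (r * (r - r') + (r - r') * r') \<le> 1/2 * norm (r - r') + norm (r - r') * (1/2)"
      using that
      by (intro order_trans[OF norm_triangle_ineq] add_mono order_trans[OF norm_mult_ineq] mult_mono)
        (auto simp: C_def)
    moreover have "f r - f r' = (1/2) *\<^sub>R (r * (r - r') + (r - r') * r')"
      by (simp add: f_def algebra_simps)
    ultimately show ?thesis by (simp add: dist_norm)
  qed
  ultimately obtain r where r: "r \<in> C" "f r = r"
    using Banach_fix[of C "1/2" f] by (metis (no_types) zero_le_divide_1_iff half_bounded_equal
        divide_less_eq_1_pos one_less_numeral_iff semiring_norm(76) zero_le_numeral zero_less_numeral)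
  have "r + r = 2 *\<^sub>R f r" using r by (simp add: scaleR_2)
  then have "r + r - r * r = h * h" by (simp add: f_def)
  with r show ?thesis by (intro that[of r]) (auto simp: C_def)
qed

text \<open>
  In the unitization this is \<open>\<parallel>1 - e\<parallel> \<le> 1\<close>, as an operator of right multiplication.
\<close>

definition co_contractive :: "'a::cstar_algebra \<Rightarrow> bool" where
  "co_contractive e \<longleftrightarrow> (\<forall>x. norm (x - x * e) \<le> norm x)"

text \<open>
  With \<open>s = 1 - r\<close> the square root of \<open>1 - h\<^sup>2\<close>, the elements \<open>h \<plusminus> i s\<close> are unitary, so
  \<open>s = ((h + i s) - (h - i s))/(2 i)\<close> acts with norm at most 1, and hence so does \<open>s\<^sup>2 = 1 - h\<^sup>2\<close>.
\<close>

lemma co_contractive_square: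
  fixes h :: "'a::cstar_algebra"
  assumes h: "star h = h" and small: "(norm h)\<^sup>2 \<le> 3/4"
  shows "co_contractive (h * h)"
proof -
  obtain r where r: "star r = r" "h * r = r * h" "r + r - r * r = h * h"
    using hermitian_sqrt_one_minus_square[OF assms] .
  have contr: "norm (x - x * r) \<le> norm x" for x
  proof -
    define y z where "y = x * h" and "z = x - x * r"
    have "y * star y + z * star z = x * (h * h + r * r - (r + r)) * star x + x * star x"
      by (simp add: y_def z_def star_mult star_diff h r(1) algebra_simps)
    also have "h * h + r * r - (r + r) = 0"
      using r(3) by (simp add: algebra_simps)
    finally have sq: "y * star y + z * star z = x * star x" by simp
    have "z * star y = x * h * star x - x * (r * h) * star x"
      by (simp add: y_def z_def star_mult star_diff h r(1) algebra_simps)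
    also have "\<dots> = y * star z"
      unfolding r(2)[symmetric] by (simp add: y_def z_def star_mult star_diff h r(1) algebra_simps)
    finally have comm: "z * star y = y * star z" .
    \<comment> \<open>The two values of \<open>c\<close> are \<open>\<plusminus>i\<close>.\<close>
    have unit: "norm (y + c *\<^sub>C z) = norm x" if c: "c * c = -1" "cnj c = - c" for c
    proof -
      have m: "(- c) *\<^sub>C v = - (c *\<^sub>C v)" for v :: 'a
        using scaleC_scaleC[of "-1" c v] by (simp add: scaleC_minus_one)
      have "(y + c *\<^sub>C z) * star (y + c *\<^sub>C z)
          = y * star y - c *\<^sub>C (y * star z) + c *\<^sub>C (z * star y) - c *\<^sub>C c *\<^sub>C (z * star z)"
        by (simp add: star_add star_scaleC c m algebra_simps scaleC_mult_left scaleC_mult_right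
            scaleC_add_right)
      also have "\<dots> = x * star x"
        by (simp add: scaleC_scaleC c scaleC_minus_one comm sq)
      finally show ?thesis
        using cstar_identity'[of "y + c *\<^sub>C z"] cstar_identity'[of x] by simp
    qed
    have "2 *\<^sub>R z = (- \<i>) *\<^sub>C (y + \<i> *\<^sub>C z) + \<i> *\<^sub>C (y + (- \<i>) *\<^sub>C z)"
    proof -
      have "(- \<i>) *\<^sub>C y + \<i> *\<^sub>C y = 0"
        using scaleC_add_left[of "-\<i>" \<i> y] scaleC_of_real[of 0 y] by simp
      then show ?thesis
        using scaleC_of_real[of 1 z]
        by (simp add: scaleC_add_right scaleC_scaleC scaleR_2 algebra_simps)
    qed
    then have "norm (2 *\<^sub>R z) \<le> norm x + norm x"
      using norm_triangle_ineq[of "(- \<i>) *\<^sub>C (y + \<i> *\<^sub>C z)" "\<i> *\<^sub>C (y + (- \<i>) *\<^sub>C z)"]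
        unit[of \<i>] unit[of "-\<i>"] by (simp add: norm_scaleC)
    then show ?thesis by (simp add: z_def)
  qed
  show ?thesis unfolding co_contractive_def
  proof
    fix x
    have "x - x * (h * h) = (x - x * r) - (x - x * r) * r"
      by (simp add: r(3)[symmetric] algebra_simps)
    then have "norm (x - x * (h * h)) \<le> norm (x - x * r)"
      using contr[of "x - x * r"] by (simp only:)
    then show "norm (x - x * (h * h)) \<le> norm x"
      using contr[of x] by (rule order_trans)
  qed
qed

text \<open>
  Surjectivity of \<open>1 - T\<close>, which takes the place of inverses in the unitization.
\<close>

lemma contraction_equation_solvable:
  fixes T :: "'a::complex_banach \<Rightarrow> 'a"
  assumes "linear T" "c < 1" "\<And>x. norm (T x) \<le> c * norm x"
  obtains b where "b - T b = a"
proof -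
  have c: "0 \<le> max 0 c" "max 0 c < 1" using assms(2) by auto
  have "dist (a + T x) (a + T y) \<le> max 0 c * dist x y" for x y
  proof -
    have "norm (T (x - y)) \<le> max 0 c * norm (x - y)"
      by (rule order_trans[OF assms(3)]) (simp add: mult_right_mono)
    then show ?thesis by (simp add: dist_norm linear_diff[OF assms(1)])
  qed
  then obtain b where "a + T b = b"
    using banach_fix_type[of "max 0 c" "\<lambda>x. a + T x"] c by auto
  then show ?thesis by (intro that[of b]) (simp add: algebra_simps)
qed

text \<open>
  Apply \<open>e\<close> on the right to \<open>e\<^sup>*\<close> and use the C*-identity.
\<close>

lemma co_contractive_norm_le:
  assumes "co_contractive (e::'a::cstar_algebra)"
  shows "norm e \<le> 2"
proof (cases "e = 0")
  case False
  have "norm (star e * e) \<le> norm (star e) + norm (star e - star e * e)"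
    using norm_triangle_ineq4[of "star e" "star e - star e * e"] by simp
  also have "\<dots> \<le> 2 * norm e" using assms by (simp add: co_contractive_def) (metis norm_star)
  finally have "(norm e)\<^sup>2 \<le> 2 * norm e" by (simp add: cstar_identity)
  with False show ?thesis by (simp add: power2_eq_square)
qed simp

text \<open>
  The element \<open>e\<close> is given by \<open>1 - e = (1 + n p)\<^sup>-\<^sup>1\<close>. For \<open>s = n/(n+1)\<close> one has
  \<open>1 + n p = (n + 1) (1 - s (1 - p))\<close>, so this inverse exists as a Neumann series, whose norm is at most
  \<open>(1/(n+1)) \<Sum> s\<^sup>k = 1\<close>. The last equation says that \<open>p (1 - e) = e/n\<close>.
\<close>

lemma hermitian_resolvent:
  fixes p :: "'a::cstar_algebra" and n :: real
  assumes p: "star p = p" "co_contractive p" and n: "0 < n"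
  obtains e where "star e = e" "co_contractive e" "n *\<^sub>R (p - p * e) = e"
proof -
  define s where "s = n / (n + 1)"
  have s: "0 \<le> s" "s < 1" "(n + 1) * s = n" using n by (auto simp: s_def)
  have lin: "linear (\<lambda>x. s *\<^sub>R (x - x * p))" by (rule linearI) (simp_all add: algebra_simps)
  have "norm (s *\<^sub>R (x - x * p)) \<le> s * norm x" for x
    using p(2) s(1) by (simp add: co_contractive_def mult_left_mono)
  from contraction_equation_solvable[OF lin s(2) this]
  obtain e where "e - s *\<^sub>R (e - e * p) = s *\<^sub>R p" .
  then have "(n + 1) *\<^sub>R (e - s *\<^sub>R (e - e * p)) = (n + 1) *\<^sub>R s *\<^sub>R p" by simp
  then have "(n + 1) *\<^sub>R e - n *\<^sub>R (e - e * p) = n *\<^sub>R p"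
    by (simp only: scaleR_diff_right[of "n+1"] scaleR_scaleR s)
  then have e: "e + n *\<^sub>R (e * p) = n *\<^sub>R p" by (simp add: algebra_simps)
  from arg_cong[OF e, of star] have e': "star e + n *\<^sub>R (p * star e) = n *\<^sub>R p"
    by (simp add: star_add star_scaleR star_mult p)
  \<comment> \<open>So far \<open>1 - e\<close> is a left inverse of \<open>1 + n p\<close> and \<open>1 - e\<^sup>*\<close> a right inverse, so they are equal.\<close>
  have "n *\<^sub>R (e * p) - n *\<^sub>R (e * p) * star e = e * (n *\<^sub>R p - n *\<^sub>R (p * star e))"
    by (simp add: algebra_simps)
  also have "n *\<^sub>R p - n *\<^sub>R (p * star e) = star e" using e' by (simp add: algebra_simps)
  also have "n *\<^sub>R (e * p) = n *\<^sub>R p - e" using e by (simp add: algebra_simps)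
  finally have "n *\<^sub>R p - n *\<^sub>R (p * star e) = e" by (simp add: algebra_simps)
  with e' have se: "star e = e" by (simp add: algebra_simps)
  have "norm (x - x * e) \<le> norm x" for x
  proof -
    define y where "y = x - x * e"
    have "(n + 1) *\<^sub>R y - n *\<^sub>R (y - y * p) = x - x * (e + n *\<^sub>R (e * p)) + x * (n *\<^sub>R p)"
      by (simp add: y_def algebra_simps)
    also have "\<dots> = x" by (simp add: e)
    finally have "(n + 1) *\<^sub>R y = x + n *\<^sub>R (y - y * p)" by (simp only: diff_eq_eq)
    then have "norm ((n + 1) *\<^sub>R y) \<le> norm x + norm (n *\<^sub>R (y - y * p))"
      by (simp only: norm_triangle_ineq)
    also have "\<dots> \<le> norm x + n * norm y"
      using n p(2) by (simp add: co_contractive_def mult_left_mono)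
    finally have "(n + 1) * norm y \<le> norm x + n * norm y" using n by simp
    then show ?thesis by (simp add: algebra_simps y_def)
  qed
  moreover have "n *\<^sub>R (p - p * e) = e" using e' by (simp add: se algebra_simps)
  ultimately show ?thesis using se by (intro that[of e]) (auto simp: co_contractive_def)
qed

text \<open>
  With \<open>z = a\<^sup>* a\<close>, let \<open>1 - e\<close> be the resolvent of \<open>p = z\<^sup>2\<close>. The C*-identity, used twice, gives
  \<open>\<parallel>a (1 - e)\<parallel>\<^sup>4 \<le> \<parallel>z (1 - e)\<parallel>\<^sup>2 \<le> \<parallel>z\<^sup>2 (1 - e)\<parallel> = \<parallel>e\<parallel>/n \<le> 2/n\<close>. The square of \<open>z\<close> appears because the
  contraction property is known for squares of hermitian elements of norm at most \<open>\<surd>(3/4)\<close>; the bound on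
  \<open>\<parallel>a\<parallel>\<close> takes care of the norm of \<open>z\<close>.
\<close>

lemma approximate_unit_small:
  fixes a :: "'a::cstar_algebra"
  assumes small: "norm a \<le> 3/4" and "0 < \<epsilon>"
  obtains e where "co_contractive e" "norm (a - a * e) < \<epsilon>"
proof -
  define z where "z = star a * a"
  have z: "star z = z" by (simp add: z_def star_mult star_star)
  have "norm z \<le> 3/4 * (3/4)"
    unfolding z_def using small by (intro order_trans[OF norm_mult_ineq] mult_mono) auto
  then have "(norm z)\<^sup>2 \<le> (3/4 * (3/4))\<^sup>2" by (intro power_mono) auto
  then have "(norm z)\<^sup>2 \<le> 3/4" by (simp add: power2_eq_square)
  from co_contractive_square[OF z this] have p: "co_contractive (z * z)" .
  define n where "n = 3 / \<epsilon> ^ 4"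
  have n: "0 < n" using \<open>0 < \<epsilon>\<close> by (simp add: n_def)
  have "star (z * z) = z * z" by (simp add: star_mult z)
  from hermitian_resolvent[OF this p n]
  obtain e where e: "star e = e" "co_contractive e" "n *\<^sub>R (z * z - z * z * e) = e" .
  have left: "norm (w - e * w) \<le> norm w" for w
  proof -
    have "norm (star w - star w * e) \<le> norm w" using e(2) by (metis co_contractive_def norm_star)
    moreover have "star w - star w * e = star (w - e * w)" by (simp add: star_diff star_mult e)
    ultimately show ?thesis by simp
  qed
  have "norm (n *\<^sub>R (z * z - z * z * e)) \<le> 2"
    using co_contractive_norm_le[OF e(2)] e(3) by simp
  then have p_small: "n * norm (z * z - z * z * e) \<le> 2" using n by simp
  have "(norm (z - z * e))\<^sup>2 = norm ((z * z - z * z * e) - e * (z * z - z * z * e))"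
    by (simp add: cstar_identity[symmetric] star_diff star_mult z e(1) algebra_simps)
  also have "\<dots> \<le> norm (z * z - z * z * e)" by (rule left)
  finally have z_small: "(norm (z - z * e))\<^sup>2 \<le> norm (z * z - z * z * e)" .
  have "(norm (a - a * e))\<^sup>2 = norm ((z - z * e) - e * (z - z * e))"
    by (simp add: cstar_identity[symmetric] star_diff star_mult z_def e(1) algebra_simps)
  also have "\<dots> \<le> norm (z - z * e)" by (rule left)
  finally have "((norm (a - a * e))\<^sup>2)\<^sup>2 \<le> (norm (z - z * e))\<^sup>2" by (intro power_mono) auto
  then have "(norm (a - a * e)) ^ 4 \<le> norm (z * z - z * z * e)" using z_small by simp
  then have "n * norm (a - a * e) ^ 4 \<le> 2"
    using p_small n by (meson mult_left_mono order_trans less_imp_le)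
  then have "norm (a - a * e) ^ 4 < \<epsilon> ^ 4"
    using \<open>0 < \<epsilon>\<close> by (simp add: n_def divide_simps)
      (smt (verit) zero_less_power)
  then have "norm (a - a * e) < \<epsilon>" using \<open>0 < \<epsilon>\<close> by (meson less_imp_le power_less_imp_less_base)
  with e(2) show ?thesis by (rule that)
qed

text \<open>
  To add an element \<open>a\<close> to the finite set, multiply \<open>1 - e\<close> on the right by \<open>1 - f\<close>, where \<open>f\<close> is an approximate unit
  for \<open>a (1 - e)\<close>; as \<open>1 - f\<close> is contractive, the other estimates persist.
\<close>

lemma approximate_unit:
  fixes F :: "'a::cstar_algebra set"
  assumes "finite F" "0 < \<epsilon>"
  shows "\<exists>e. co_contractive e \<and> (\<forall>a\<in>F. norm (a - a * e) < \<epsilon>)"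
  using assms(1)
proof induction
  case empty
  show ?case by (rule exI[of _ 0]) (simp add: co_contractive_def)
next
  case (insert a F)
  then obtain e where e: "co_contractive e" "\<forall>b\<in>F. norm (b - b * e) < \<epsilon>" by blast
  define c where "c = a - a * e"
  define t where "t = 3 / (4 * (norm c + 1))"
  have t: "0 < t" by (simp add: t_def add_nonneg_pos)
  have "norm c < norm c + 1" by simp
  then have "norm (t *\<^sub>R c) \<le> 3/4"
    using norm_ge_zero[of c] by (simp add: t_def divide_simps del: norm_ge_zero)
  from approximate_unit_small[OF this, of "t * \<epsilon>"] t \<open>0 < \<epsilon>\<close>
  obtain f where f: "co_contractive f" "norm (t *\<^sub>R c - t *\<^sub>R c * f) < t * \<epsilon>" by auto
  have "norm (t *\<^sub>R (c - c * f)) < t * \<epsilon>" using f(2) by (simp add: algebra_simps)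
  then have cf: "norm (c - c * f) < \<epsilon>" using t by simp
  define g where "g = e + f - e * f"
  have g: "x - x * g = (x - x * e) - (x - x * e) * f" for x by (simp add: g_def algebra_simps)
  have le: "norm (x - x * g) \<le> norm (x - x * e)" for x
    unfolding g using f(1) by (simp add: co_contractive_def)
  have "co_contractive g"
    unfolding co_contractive_def using le e(1) by (meson co_contractive_def order_trans)
  moreover have "norm (b - b * g) < \<epsilon>" if "b \<in> insert a F" for b
    using that cf e(2) le[of b] by (auto simp: g c_def)
  ultimately show ?case by blast
qed

section \<open>Factorization of null sequences\<close>

lemma approximate_unit_left:
  fixes F :: "'a::cstar_algebra set"
  assumes "finite F" "0 < \<epsilon>"
  shows "\<exists>f. \<forall>b\<in>F. norm (b - f * b) < \<epsilon>"
proof -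
  obtain e where e: "\<forall>c\<in>star ` F. norm (c - c * e) < \<epsilon>"
    using approximate_unit[of "star ` F" \<epsilon>] assms by blast
  have "norm (b - star e * b) < \<epsilon>" if "b \<in> F" for b
  proof -
    have "b - star e * b = star (star b - star b * e)"
      by (simp add: star_diff star_mult star_star)
    then show ?thesis using e that by simp
  qed
  then show ?thesis by blast
qed

lemma geometric_increments_convergent:
  fixes f :: "nat \<Rightarrow> 'a::banach"
  assumes "\<And>k. N \<le> k \<Longrightarrow> norm (f (Suc k) - f k) \<le> (1/2) ^ k"
  shows "convergent f"
proof -
  have "summable (\<lambda>k. f (Suc k) - f k)"
    by (rule summable_comparison_test[of _ "\<lambda>k. (1/2) ^ k"]) (use assms in auto)
  then have "convergent (\<lambda>n. (\<Sum>k<n. f (Suc k) - f k) + f 0)"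
    by (intro convergent_add convergent_const) (simp add: summable_iff_convergent)
  then show ?thesis by (simp add: sum_lessThan_telescope)
qed

text \<open>
  Cohen's factorization, for sequences that decay geometrically. Put \<open>d\<^sub>k = 2\<^bsup>-k\<^esup> + s\<^sub>k\<close> with
  \<open>s\<^sub>k = \<Sum>\<^sub>j\<^sub>\<le>\<^sub>k 2\<^bsup>-j\<^esup> e\<^sub>j\<close> for suitable approximate units \<open>e\<^sub>j\<close>. Then \<open>1 - d\<^sub>k = \<Sum>\<^sub>j\<^sub>\<le>\<^sub>k 2\<^bsup>-j\<^esup> (1 - e\<^sub>j)\<close> has norm
  at most \<open>1 - 2\<^bsup>-k\<^esup>\<close>, so \<open>d\<^sub>k\<close> is invertible, with \<open>\<parallel>d\<^sub>k\<^sup>-\<^sup>1\<parallel> \<le> 2\<^sup>k\<close>, although its limit \<open>d\<close>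
  lies in the algebra. The elements \<open>a\<^sub>n d\<^sub>k\<^sup>-\<^sup>1\<close> converge as \<open>k \<rightarrow> \<infinity>\<close> if \<open>e\<^sub>k\<^sub>+\<^sub>1\<close> is chosen, after \<open>d\<^sub>k\<close>, as an
  approximate unit for them, because
  \<open>a\<^sub>n d\<^sub>k\<^sub>+\<^sub>1\<^sup>-\<^sup>1 - a\<^sub>n d\<^sub>k\<^sup>-\<^sup>1 = a\<^sub>n d\<^sub>k\<^sup>-\<^sup>1 2\<^bsup>-k-1\<^esup> (1 - e\<^sub>k\<^sub>+\<^sub>1) d\<^sub>k\<^sub>+\<^sub>1\<^sup>-\<^sup>1\<close>. At each step finitely many \<open>n\<close> are dealt with,
  which suffices as \<open>\<parallel>a\<^sub>n d\<^sub>n\<^sup>-\<^sup>1\<parallel> \<le> 2\<^sup>n \<parallel>a\<^sub>n\<parallel> \<le> 1\<close>.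
\<close>

lemma cohen_factorization:
  fixes a :: "nat \<Rightarrow> 'a::cstar_algebra"
  assumes a: "\<And>n. norm (a n) \<le> (1/2) ^ n"
  obtains d u where "\<And>n. a n = u n * d" "\<And>n. norm (u n) \<le> 3"
proof -
  \<comment> \<open>The states are pairs \<open>(s\<^sub>k, n \<mapsto> a\<^sub>n d\<^sub>k\<^sup>-\<^sup>1)\<close>.\<close>
  define P :: "nat \<Rightarrow> 'a \<times> (nat \<Rightarrow> 'a) \<Rightarrow> bool" where
    "P k x \<longleftrightarrow> (\<forall>y. norm (y - ((1/2) ^ k *\<^sub>R y + y * fst x)) \<le> (1 - (1/2) ^ k) * norm y)
      \<and> (\<forall>n. (1/2) ^ k *\<^sub>R snd x n + snd x n * fst x = a n)
      \<and> (k = 0 \<longrightarrow> x = (0, a))" for k x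
  define Q :: "nat \<Rightarrow> 'a \<times> (nat \<Rightarrow> 'a) \<Rightarrow> 'a \<times> (nat \<Rightarrow> 'a) \<Rightarrow> bool" where
    "Q k x x' \<longleftrightarrow> norm (fst x' - fst x) \<le> (1/2) ^ k
      \<and> (\<forall>n\<le>k. norm (snd x' n - snd x n) \<le> (1/2) ^ k)" for k x x'
  have "\<exists>x. P 0 x" by (rule exI[of _ "(0, a)"]) (simp add: P_def)
  moreover have "\<exists>x'. P (Suc k) x' \<and> Q k x x'" if "P k x" for x k
  proof -
    obtain s b where x: "x = (s, b)" by (cases x)
    have s: "norm (y - ((1/2) ^ k *\<^sub>R y + y * s)) \<le> (1 - (1/2) ^ k) * norm y" for y
      using that by (simp add: P_def x)
    have b: "(1/2) ^ k *\<^sub>R b n + b n * s = a n" for n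
      using that by (simp add: P_def x)
    obtain e where e: "co_contractive e" "\<forall>n\<le>k. norm (b n - b n * e) < (1/2) ^ k"
      using approximate_unit[of "b ` {..k}" "(1/2) ^ k"] by auto
    define r :: real where "r = (1/2) ^ Suc k"
    have r: "0 < r" "(1/2) ^ k = 2 * r" by (simp_all add: r_def)
    define s' where "s' = s + r *\<^sub>R e"
    define D where "D y = r *\<^sub>R y + y * s'" for y
    have lin: "linear (\<lambda>y. y - D y)" by (rule linearI) (simp_all add: D_def algebra_simps)
    have D: "norm (y - D y) \<le> (1 - r) * norm y" for y
    proof -
      have "y - D y = (y - ((2 * r) *\<^sub>R y + y * s)) + r *\<^sub>R (y - y * e)"
        by (simp add: D_def s'_def algebra_simps) (simp add: scaleR_2 scaleR_add_right flip: scaleR_scaleR)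
      also have "norm \<dots> \<le> (1 - 2 * r) * norm y + r * norm y"
        using s[of y] e(1) r
        by (intro order_trans[OF norm_triangle_ineq] add_mono)
          (simp_all add: co_contractive_def mult_left_mono)
      finally show ?thesis by (simp add: algebra_simps)
    qed
    have lower: "r * norm y \<le> norm (D y)" for y
      using norm_triangle_ineq[of "D y" "y - D y"] D[of y] by (simp add: algebra_simps)
    have "\<exists>c. D c = a n" for n
      using contraction_equation_solvable[OF lin _ D, where a = "a n"] r(1) by auto
    then obtain b' where b': "\<And>n. D (b' n) = a n" by metis
    have "norm (b' n - b n) \<le> norm (b n - b n * e)" for n
    proof -
      have "D (b' n - b n) = a n - D (b n)"
        by (simp add: b'[of n, symmetric]) (simp add: D_def algebra_simps)
      also have "\<dots> = (2 * r) *\<^sub>R b n + b n * s - D (b n)"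
        using b[of n] by (simp add: r(2))
      also have "\<dots> = r *\<^sub>R (b n - b n * e)"
        by (simp add: D_def s'_def algebra_simps) (simp add: scaleR_2 scaleR_add_right flip: scaleR_scaleR)
      finally show ?thesis using lower[of "b' n - b n"] r(1) by simp
    qed
    then have "\<forall>n\<le>k. norm (b' n - b n) \<le> (1/2) ^ k"
      using e(2) by (meson less_imp_le order_trans)
    moreover have "norm (s' - s) \<le> (1/2) ^ k"
      using co_contractive_norm_le[OF e(1)] r by (simp add: s'_def)
    ultimately have "Q k x (s', b')" by (simp add: Q_def x)
    moreover have "P (Suc k) (s', b')"
      using D b' by (simp add: P_def D_def r_def)
    ultimately show ?thesis by blast
  qed
  ultimately obtain x where x: "\<And>k. P k (x k)" "\<And>k. Q k (x k) (x (Suc k))"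
    using dependent_nat_choice[of P Q] by metis
  define s b where "s k = fst (x k)" and "b n k = snd (x k) n" for k n
  have eq: "(1/2) ^ k *\<^sub>R b n k + b n k * s k = a n" for k n
    using x(1)[of k] by (simp add: P_def s_def b_def)
  have "convergent s"
    by (rule geometric_increments_convergent[of 0]) (use x(2) in \<open>simp add: Q_def s_def\<close>)
  then obtain d where d: "s \<longlonglongrightarrow> d" by (auto simp: convergent_def)
  have inc: "norm (b n (Suc k) - b n k) \<le> (1/2) ^ k" if "n \<le> k" for n k
    using x(2)[of k] that by (simp add: Q_def b_def)
  have "\<exists>l. b n \<longlonglongrightarrow> l" for n
    using geometric_increments_convergent[of n "b n"] inc by (simp add: convergent_def)
  then obtain u where u: "\<And>n. b n \<longlonglongrightarrow> u n" by metis
  have "a n = u n * d" for n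
  proof -
    have "(\<lambda>k. (1/2) ^ k *\<^sub>R b n k + b n k * s k) \<longlonglongrightarrow> 0 *\<^sub>R u n + u n * d"
      by (intro tendsto_intros u d LIMSEQ_realpow_zero) auto
    then have "(\<lambda>k. a n) \<longlonglongrightarrow> u n * d" by (simp add: eq)
    then show ?thesis using LIMSEQ_const_iff by blast
  qed
  moreover have "norm (u n) \<le> 3" for n
  proof -
    have start: "norm (b n n) \<le> 1"
    proof -
      have "norm (b n n - ((1/2) ^ n *\<^sub>R b n n + b n n * s n)) \<le> (1 - (1/2) ^ n) * norm (b n n)"
        using x(1)[of n] by (simp add: P_def s_def)
      then have "norm (b n n - a n) \<le> (1 - (1/2) ^ n) * norm (b n n)" by (simp only: eq)
      then have "(1/2) ^ n * norm (b n n) \<le> norm (b n n) - norm (b n n - a n)"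
        by (simp add: algebra_simps)
      also have "\<dots> \<le> (1/2) ^ n"
        using norm_triangle_ineq[of "a n" "b n n - a n"] a[of n] by simp
      finally have "(1/2) ^ n * norm (b n n) \<le> (1/2) ^ n * 1" by simp
      then show ?thesis by (subst (asm) mult_le_cancel_left_pos) simp_all
    qed
    \<comment> \<open>The right-hand side grows by \<open>2\<^bsup>-k\<^esup>\<close> from \<open>k\<close> to \<open>k + 1\<close>, which is the most that the norm can grow.\<close>
    have "norm (b n k) \<le> 3 - 2 * (1/2) ^ k" if "n \<le> k" for k
      using that
    proof (induction k rule: dec_induct)
      case base
      have "((1::real)/2) ^ n \<le> 1" by (simp add: power_le_one)
      then show ?case using start by linarith
    next
      case (step k)
      then show ?case
        using inc[of n k] norm_triangle_ineq[of "b n k" "b n (Suc k) - b n k"] by simp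
    qed
    then have "\<forall>\<^sub>F k in sequentially. norm (b n k) \<le> 3"
      unfolding eventually_sequentially
      by (intro exI[of _ n]) (smt (verit) zero_le_power divide_nonneg_pos)
    then show ?thesis
      by (rule tendsto_upperbound[OF tendsto_norm[OF u]]) simp
  qed
  ultimately show ?thesis by (rule that)
qed

lemma cohen_factorization_left:
  fixes a :: "nat \<Rightarrow> 'a::cstar_algebra"
  assumes a: "\<And>n. norm (a n) \<le> (1/2) ^ n"
  obtains d u where "\<And>n. a n = d * u n" "\<And>n. norm (u n) \<le> 3"
proof -
  have "norm (star (a n)) \<le> (1/2) ^ n" for n using a by simp
  then obtain d u where du: "\<And>n. star (a n) = u n * d" "\<And>n. norm (u n) \<le> 3"
    using cohen_factorization[of "\<lambda>n. star (a n)"] by blast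
  have "a n = star d * star (u n)" for n
    using arg_cong[OF du(1)[of n], of star] by (simp add: star_star star_mult)
  with du(2) show ?thesis by (intro that[of "star d" "\<lambda>n. star (u n)"]) auto
qed

section \<open>Norming elements in Hilbert bimodules\<close>

text \<open>
  From \<open>\<parallel>h\<parallel>\<^sup>4 = \<parallel>h\<^sup>4\<parallel> \<le> \<parallel>h\<^sup>3\<parallel> \<parallel>h\<parallel>\<close>.
\<close>

lemma norm_hermitian_cube:
  assumes "star h = (h::'a::cstar_algebra)"
  shows "norm (h * h * h) = norm h ^ 3"
proof (cases "h = 0")
  case False
  have sq: "norm (h * h) = (norm h)\<^sup>2" using cstar_identity[of h] assms by simp
  have "norm (h * h * (h * h)) = (norm (h * h))\<^sup>2"
    using cstar_identity[of "h * h"] assms by (simp add: star_mult)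
  then have "norm h * norm h ^ 3 = norm (h * h * h * h)"
    by (simp add: sq mult.assoc power2_eq_square power3_eq_cube)
  also have "\<dots> \<le> norm h * norm (h * h * h)"
    using norm_mult_ineq[of "h * h * h" h] by (simp add: mult.commute)
  finally have "norm h ^ 3 \<le> norm (h * h * h)" using False by simp
  moreover have "norm (h * h * h) \<le> norm h ^ 3"
    using norm_mult_ineq[of "h * h" h] by (simp add: sq power2_eq_square power3_eq_cube)
  ultimately show ?thesis by simp
qed simp

context left_hilbert_module
begin

lemma norm_linner_self: "norm (linner x x) = (norm x)\<^sup>2"
  using norm_linner[of x] by simp

lemma linner_lact_right: "linner x (lact a y) = linner x y * star a"
  by (metis linner_lact linner_star star_mult)

lemma norm_lact_le: "norm (lact a x) \<le> norm a * norm x"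
proof -
  have "(norm (lact a x))\<^sup>2 = norm (a * linner x x * star a)"
    by (simp add: norm_linner_self[symmetric] linner_lact linner_lact_right mult.assoc)
  also have "\<dots> \<le> norm a * (norm x)\<^sup>2 * norm a"
    using norm_mult_ineq[of "a * linner x x" "star a"] norm_mult_ineq[of a "linner x x"]
    by (smt (verit) mult_right_mono norm_ge_zero norm_linner_self norm_star)
  also have "\<dots> = (norm a * norm x)\<^sup>2" by (simp add: power2_eq_square)
  finally show ?thesis by (rule power2_le_imp_le) simp
qed

text \<open>
  For \<open>h = \<langle>y,y\<rangle>\<close> one has \<open>\<parallel>h y\<parallel>\<^sup>2 = \<parallel>h\<^sup>3\<parallel> = \<parallel>y\<parallel>\<^sup>6\<close>, so \<open>c = h/\<parallel>y\<parallel>\<^sup>2\<close> will do.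
\<close>

lemma exists_norming_lact:
  obtains c where "norm c \<le> 1" "norm (lact c y) = norm y"
proof (cases "y = 0")
  case True
  then show ?thesis using norm_lact_le[of 0 y] by (intro that[of 0]) auto
next
  case False
  define h where "h = linner y y"
  have "(norm (lact h y))\<^sup>2 = norm (h * h * h)"
    by (simp add: norm_linner_self[symmetric] linner_lact linner_lact_right h_def linner_star
        mult.assoc)
  also have "\<dots> = ((norm y)\<^sup>2) ^ 3"
    by (simp add: norm_hermitian_cube h_def linner_star norm_linner_self)
  also have "\<dots> = (norm y ^ 3)\<^sup>2" by (simp flip: power_mult)
  finally have h: "norm (lact h y) = norm y ^ 3" by (rule power2_eq_imp_eq) simp_all
  define c where "c = complex_of_real (1 / (norm y)\<^sup>2) *\<^sub>C h"
  have "norm c \<le> 1" using False by (simp add: c_def norm_scaleC h_def norm_linner_self norm_power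
        norm_divide)
  moreover have "norm (lact c y) = norm y"
    using False by (simp add: c_def lact_scaleC_left norm_scaleC h norm_mult norm_divide
        power2_eq_square power3_eq_cube)
  ultimately show ?thesis by (rule that)
qed

lemma bounded_linear_lact: "bounded_linear (lact a)"
proof (rule bounded_linear_intro[where K = "norm a"])
  show "lact a (r *\<^sub>R x) = r *\<^sub>R lact a x" for r x
    by (simp add: scaleC_of_real[symmetric] lact_scaleC_right)
qed (simp_all add: lact_add_right norm_lact_le mult.commute)

end

context right_hilbert_module
begin

lemma norm_rinner_self: "norm (rinner x x) = (norm x)\<^sup>2"
  using norm_rinner[of x] by simp

lemma rinner_ract_left: "rinner (ract x b) y = star b * rinner x y"
  by (metis rinner_ract rinner_star star_mult)

lemma norm_ract_le: "norm (ract x b) \<le> norm x * norm b"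
proof -
  have "(norm (ract x b))\<^sup>2 = norm (star b * rinner x x * b)"
    by (simp add: norm_rinner_self[symmetric] rinner_ract rinner_ract_left)
  also have "\<dots> \<le> norm b * (norm x)\<^sup>2 * norm b"
    using norm_mult_ineq[of "star b * rinner x x" b] norm_mult_ineq[of "star b" "rinner x x"]
    by (smt (verit) mult_right_mono norm_ge_zero norm_rinner_self norm_star)
  also have "\<dots> = (norm x * norm b)\<^sup>2" by (simp add: power2_eq_square)
  finally show ?thesis by (rule power2_le_imp_le) simp
qed

lemma exists_norming_ract:
  obtains c where "norm c \<le> 1" "norm (ract y c) = norm y"
proof (cases "y = 0")
  case True
  then show ?thesis using norm_ract_le[of y 0] by (intro that[of 0]) auto
next
  case False
  define h where "h = rinner y y"
  have "(norm (ract y h))\<^sup>2 = norm (h * h * h)"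
    by (simp add: norm_rinner_self[symmetric] rinner_ract rinner_ract_left h_def rinner_star)
  also have "\<dots> = ((norm y)\<^sup>2) ^ 3"
    by (simp add: norm_hermitian_cube h_def rinner_star norm_rinner_self)
  also have "\<dots> = (norm y ^ 3)\<^sup>2" by (simp flip: power_mult)
  finally have h: "norm (ract y h) = norm y ^ 3" by (rule power2_eq_imp_eq) simp_all
  define c where "c = complex_of_real (1 / (norm y)\<^sup>2) *\<^sub>C h"
  have "norm c \<le> 1" using False by (simp add: c_def norm_scaleC h_def norm_rinner_self norm_power
        norm_divide)
  moreover have "norm (ract y c) = norm y"
    using False by (simp add: c_def ract_scaleC_right norm_scaleC h norm_mult norm_divide
        power2_eq_square power3_eq_cube)
  ultimately show ?thesis by (rule that)
qed

lemma bounded_linear_ract: "bounded_linear (\<lambda>x. ract x b)"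
proof (rule bounded_linear_intro[where K = "norm b"])
  show "ract (r *\<^sub>R x) b = r *\<^sub>R ract x b" for r x
    by (simp add: scaleC_of_real[symmetric] ract_scaleC_left)
qed (simp_all add: ract_add_left norm_ract_le)

end

section \<open>Quasi-multipliers\<close>

context hilbert_bimodule
begin

text \<open>
  Automatic continuity: if \<open>q\<close> were unbounded, it would be unbounded on a pair of geometrically decaying
  sequences \<open>a\<^sub>n = u\<^sub>n d\<close>, \<open>b\<^sub>n = f v\<^sub>n\<close>, although \<open>q(a\<^sub>n,b\<^sub>n) = u\<^sub>n q(d,f) v\<^sub>n\<close>.
\<close>

lemma module_map_bounded:
  fixes q :: "'a \<Rightarrow> 'b \<Rightarrow> 'v"
  assumes sc1: "\<And>r a b. q (r *\<^sub>R a) b = r *\<^sub>R q a b"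
    and sc2: "\<And>r a b. q a (r *\<^sub>R b) = r *\<^sub>R q a b"
    and mod: "\<And>a c b d. q (c * a) (b * d) = ract (lact c (q a b)) d"
  shows "\<exists>K. \<forall>a b. norm (q a b) \<le> norm a * norm b * K"
proof (rule ccontr)
  assume "\<not> ?thesis"
  \<comment> \<open>The factor \<open>4\<^sup>n\<close> leaves room for scaling both arguments to norm \<open>2\<^bsup>-n\<^esup>\<close>.\<close>
  then have "\<forall>n. \<exists>a b. norm a * norm b * (4 ^ n * real n) < norm (q a b)"
    by (meson not_le)
  then obtain a0 b0 where
    big: "\<And>n. norm (a0 n) * norm (b0 n) * (4 ^ n * real n) < norm (q (a0 n) (b0 n))"
    by metis
  have zero: "q 0 b = 0" "q a 0 = 0" for a b
    using sc1[of 0 0 b] sc2[of a 0 0] by simp_all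
  have nz: "a0 n \<noteq> 0" "b0 n \<noteq> 0" for n
    using big[of n] zero by auto
  define a b where "a n = ((1/2) ^ n / norm (a0 n)) *\<^sub>R a0 n"
    and "b n = ((1/2) ^ n / norm (b0 n)) *\<^sub>R b0 n" for n
  have q_big: "real n < norm (q (a n) (b n))" for n
  proof -
    have "norm (q (a n) (b n)) = norm (q (a0 n) (b0 n)) / (norm (a0 n) * norm (b0 n) * 4 ^ n)"
      by (simp add: a_def b_def sc1 sc2 power_one_over field_simps flip: power_mult_distrib)
    moreover have "0 < norm (a0 n) * norm (b0 n) * 4 ^ n" using nz[of n] by simp
    ultimately show ?thesis using big[of n] by (simp add: pos_less_divide_eq algebra_simps)
  qed
  have "norm (a n) \<le> (1/2) ^ n" "norm (b n) \<le> (1/2) ^ n" for n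
    using nz[of n] by (simp_all add: a_def b_def)
  then obtain d u f v where fac: "\<And>n. a n = u n * d" "\<And>n. norm (u n) \<le> 3"
    "\<And>n. b n = f * v n" "\<And>n. norm (v n) \<le> 3"
    using cohen_factorization[of a] cohen_factorization_left[of b] by metis
  have "real n < 9 * norm (q d f)" for n
  proof -
    have "real n < norm (ract (lact (u n) (q d f)) (v n))"
      using q_big[of n] by (simp add: fac mod)
    also have "\<dots> \<le> norm (lact (u n) (q d f)) * norm (v n)" by (rule norm_ract_le)
    also have "\<dots> \<le> 3 * norm (q d f) * 3"
      using fac by (intro mult_mono order_trans[OF norm_lact_le] mult_right_mono) auto
    finally show ?thesis by simp
  qed
  then show False using reals_Archimedean2 by (meson less_asym)
qed

lemma QM_I:
  fixes q :: "'a \<Rightarrow> 'b \<Rightarrow> 'v"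
  assumes add1: "\<And>a c b. q (a + c) b = q a b + q c b"
    and add2: "\<And>a b d. q a (b + d) = q a b + q a d"
    and sc1: "\<And>c a b. q (c *\<^sub>C a) b = c *\<^sub>C q a b"
    and sc2: "\<And>c a b. q a (c *\<^sub>C b) = c *\<^sub>C q a b"
    and mod: "\<And>a c b d. q (c * a) (b * d) = ract (lact c (q a b)) d"
  shows "q \<in> QM lact ract"
proof -
  have r: "q (r *\<^sub>R a) b = r *\<^sub>R q a b" "q a (r *\<^sub>R b) = r *\<^sub>R q a b" for r a b
    by (simp_all add: scaleC_of_real[symmetric] sc1 sc2)
  have "bounded_bilinear q"
    using module_map_bounded[OF r mod] add1 add2 r by unfold_locales auto
  then show ?thesis using sc1 sc2 mod by (simp add: QM_def)
qed

lemma qm_embed_in_QM: "qm_embed lact ract v \<in> QM lact ract"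
  by (rule QM_I) (simp_all add: qm_embed_def lact_add_left ract_add_left ract_add_right
      lact_scaleC_left ract_scaleC_left ract_scaleC_right lact_mult ract_mult actions_commute
      lact_add_right lact_scaleC_right)

text \<open>
  The supremum is attained: choose \<open>a'\<close> norming for \<open>q(a,b)\<close> and then \<open>b'\<close> norming for \<open>a' q(a,b)\<close>.
\<close>

lemma qs_seminorm_QM:
  assumes "q \<in> QM lact ract"
  shows "qs_seminorm a b q = norm (q a b)"
proof -
  let ?S = "{norm (qm_ract (qm_lact a q) b a' b') | a' b'. norm a' \<le> 1 \<and> norm b' \<le> 1}"
  have mod: "qm_ract (qm_lact a q) b a' b' = ract (lact a' (q a b)) b'" for a' b'
    using assms by (simp add: qm_ract_def qm_lact_def QM_def)
  obtain c where c: "norm c \<le> 1" "norm (lact c (q a b)) = norm (q a b)"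
    by (rule exists_norming_lact)
  obtain d where d: "norm d \<le> 1" "norm (ract (lact c (q a b)) d) = norm (lact c (q a b))"
    by (rule exists_norming_ract)
  have "norm (q a b) \<in> ?S" using c d mod by (smt (verit) mem_Collect_eq)
  moreover have "s \<le> norm (q a b)" if s_in: "s \<in> ?S" for s
  proof -
    obtain a' b' where s: "s = norm (ract (lact a' (q a b)) b')" "norm a' \<le> 1" "norm b' \<le> 1"
      using s_in by (auto simp: mod)
    have "s \<le> norm (lact a' (q a b)) * norm b'" using s(1) norm_ract_le by simp
    also have "\<dots> \<le> norm a' * norm (q a b) * norm b'"
      by (intro mult_right_mono norm_lact_le) simp
    also have "\<dots> \<le> 1 * norm (q a b) * 1" using s by (intro mult_mono) auto
    finally show ?thesis by simp
  qed
  ultimately show ?thesis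
    unfolding qs_seminorm_def qm_norm_def by (rule cSup_eq_maximum)
qed

lemma qs_seminorm_embed: "qs_seminorm a b (qm_embed lact ract v) = norm (ract (lact a v) b)"
  by (subst qs_seminorm_QM[OF qm_embed_in_QM]) (simp add: qm_embed_def)

lemma qs_seminorm_embed_diff:
  "qs_seminorm a b (qm_embed lact ract (v - w)) = dist (ract (lact a v) b) (ract (lact a w) b)"
  by (simp add: qs_seminorm_embed dist_norm
      linear_diff[OF bounded_linear.linear[OF bounded_linear_lact]]
      linear_diff[OF bounded_linear.linear[OF bounded_linear_ract]])

text \<open>
  The vector \<open>q(e,f)\<close> will do, for approximate units \<open>e\<close> and \<open>f\<close> of the two finite sets, as \<open>q\<close> is bounded and
  \<open>q(a,b) - a q(e,f) b = q(a - ae, fb) + q(a, b - fb)\<close>.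
\<close>

lemma QM_approximated:
  assumes q: "q \<in> QM lact ract" and fin: "finite F" "finite G" and "0 < \<epsilon>"
  shows "\<exists>v. \<forall>a\<in>F. \<forall>b\<in>G. dist (ract (lact a v) b) (q a b) < \<epsilon>"
proof -
  interpret bounded_bilinear q using q by (simp add: QM_def)
  obtain K where K: "0 < K" "\<And>a b. norm (q a b) \<le> norm a * norm b * K"
    using pos_bounded by blast
  define M where "M = (\<Sum>a\<in>F. norm a) + (\<Sum>b\<in>G. norm b) + 2"
  have M: "norm a \<le> M" "norm b + 1 \<le> M" if "a \<in> F" "b \<in> G" for a b
    using member_le_sum[of a F norm] member_le_sum[of b G norm] that fin
      sum_nonneg[of F norm] sum_nonneg[of G norm] by (auto simp: M_def)
  have M0: "1 < M" using sum_nonneg[of F norm] sum_nonneg[of G norm] by (simp add: M_def)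
  define \<delta> where "\<delta> = min 1 (\<epsilon> / (2 * K * M))"
  have \<delta>: "0 < \<delta>" "\<delta> \<le> 1" "2 * K * M * \<delta> \<le> \<epsilon>"
    using K M0 \<open>0 < \<epsilon>\<close> by (auto simp: \<delta>_def min_def field_simps)
  obtain e f where e: "\<forall>a\<in>F. norm (a - a * e) < \<delta>" and f: "\<forall>b\<in>G. norm (b - f * b) < \<delta>"
    using approximate_unit[OF fin(1) \<delta>(1)] approximate_unit_left[OF fin(2) \<delta>(1)] by blast
  have "dist (ract (lact a (q e f)) b) (q a b) < \<epsilon>" if ab: "a \<in> F" "b \<in> G" for a b
  proof -
    have "ract (lact a (q e f)) b = q (a * e) (f * b)" using q by (simp add: QM_def)
    then have "q a b - ract (lact a (q e f)) b = q (a - a * e) (f * b) + q a (b - f * b)"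
      by (simp add: diff_left diff_right)
    also have "norm \<dots> \<le> norm (a - a * e) * norm (f * b) * K + norm a * norm (b - f * b) * K"
      by (intro order_trans[OF norm_triangle_ineq] add_mono K)
    also have "\<dots> < \<delta> * M * K + M * \<delta> * K"
    proof -
      have "norm (f * b) \<le> M"
        using norm_triangle_ineq4[of b "b - f * b"] f ab M[OF ab] \<delta>(2) by force
      then have "norm (a - a * e) * norm (f * b) \<le> norm (a - a * e) * M"
        by (intro mult_left_mono) auto
      also have "\<dots> < \<delta> * M" using e ab M0 by (intro mult_strict_right_mono) auto
      finally have "norm (a - a * e) * norm (f * b) < \<delta> * M" .
      moreover have "norm a * norm (b - f * b) \<le> M * \<delta>"
        using M[OF ab] M0 f ab \<delta>(1) by (intro mult_mono) (auto intro: less_imp_le)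
      ultimately show ?thesis
        using K(1) by (intro add_less_le_mono mult_strict_right_mono mult_right_mono) auto
    qed
    also have "\<dots> \<le> \<epsilon>" using \<delta>(3) by (simp add: algebra_simps)
    finally show ?thesis by (simp add: dist_norm norm_minus_commute)
  qed
  then show ?thesis by blast
qed

end

section \<open>Quasi-strictly convergent nets\<close>

lemma eventually_tails:
  assumes "directed_net x"
  shows "eventually P (tails x) \<longleftrightarrow> (\<exists>k\<in>idx x. \<forall>i\<in>idx x. le x k i \<longrightarrow> P i)"
proof -
  have "\<exists>k\<in>idx x. principal {l \<in> idx x. le x k l}
      \<le> inf (principal {l \<in> idx x. le x i l}) (principal {l \<in> idx x. le x j l})"
    if ij: "i \<in> idx x" "j \<in> idx x" for i j
  proof -
    obtain k where k: "k \<in> idx x" "le x i k" "le x j k"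
      using assms ij unfolding directed_net_def by blast
    have "le x i l \<and> le x j l" if "l \<in> idx x" "le x k l" for l
      using assms ij k that unfolding directed_net_def by blast
    then show ?thesis using k(1) by (intro bexI[of _ k]) auto
  qed
  moreover have "idx x \<noteq> {}" using assms by (simp add: directed_net_def)
  ultimately show ?thesis
    unfolding tails_def by (subst eventually_INF_base) (auto simp: eventually_principal)
qed

lemma tails_neq_bot: "directed_net x \<Longrightarrow> tails x \<noteq> bot"
  unfolding trivial_limit_def by (simp add: eventually_tails) (meson directed_net_def)

definition qs_limit ::
    "('a::cstar_algebra \<Rightarrow> 'v::complex_banach \<Rightarrow> 'v) \<Rightarrow> ('v \<Rightarrow> 'b::cstar_algebra \<Rightarrow> 'v)
      \<Rightarrow> ('i, 'v) net \<Rightarrow> ('a \<Rightarrow> 'b \<Rightarrow> 'v) \<Rightarrow> bool" where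
  "qs_limit lact ract x q \<longleftrightarrow> directed_net x \<and>
     (\<forall>a b. ((\<lambda>i. ract (lact a (pt x i)) b) \<longlongrightarrow> q a b) (tails x))"

text \<open>
  The classes that make up the completion will turn out to be these sets, for \<open>q \<in> QM(V)\<close>.
\<close>

definition qs_nets ::
    "('a::cstar_algebra \<Rightarrow> 'v::complex_banach \<Rightarrow> 'v) \<Rightarrow> ('v \<Rightarrow> 'b::cstar_algebra \<Rightarrow> 'v)
      \<Rightarrow> ('a \<Rightarrow> 'b \<Rightarrow> 'v) \<Rightarrow> ('v \<times> 'v set, 'v) net set" where
  "qs_nets lact ract q = {x. qs_limit lact ract x q}"

lemma qs_limit_iff:
  "qs_limit lact ract x q \<longleftrightarrow> directed_net x \<and>
     (\<forall>a b. \<forall>e>0. \<exists>k\<in>idx x. \<forall>i\<in>idx x. le x k i \<longrightarrow> dist (ract (lact a (pt x i)) b) (q a b) < e)"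
  by (auto simp: qs_limit_def tendsto_iff eventually_tails)

lemma q_lim_eq:
  assumes "qs_limit lact ract x q"
  shows "q_lim lact ract x = q"
  using assms tails_neq_bot[of x]
  by (auto simp: q_lim_def qs_limit_def fun_eq_iff intro!: tendsto_Lim)

lemma tails_net_add:
  assumes "directed_net x" "directed_net y"
  shows "directed_net (net_add x y)"
    and "filterlim fst (tails x) (tails (net_add x y))"
    and "filterlim snd (tails y) (tails (net_add x y))"
proof -
  show d: "directed_net (net_add x y)"
    unfolding directed_net_def
  proof (intro conjI ballI impI)
    show "idx (net_add x y) \<noteq> {}"
      using assms by (simp add: directed_net_def net_add_def)
    show "le (net_add x y) i i" if "i \<in> idx (net_add x y)" for i
      using assms that by (auto simp: directed_net_def net_add_def)
    show "le (net_add x y) i k"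
      if "i \<in> idx (net_add x y)" "j \<in> idx (net_add x y)" "k \<in> idx (net_add x y)"
        "le (net_add x y) i j" "le (net_add x y) j k" for i j k
    proof -
      have "le x (fst i) (fst k)"
        using assms(1)[unfolded directed_net_def, THEN conjunct2, THEN conjunct2, THEN conjunct1,
            rule_format, of "fst i" "fst j" "fst k"] that
        by (simp add: net_add_def split_beta mem_Times_iff)
      moreover have "le y (snd i) (snd k)"
        using assms(2)[unfolded directed_net_def, THEN conjunct2, THEN conjunct2, THEN conjunct1,
            rule_format, of "snd i" "snd j" "snd k"] that
        by (simp add: net_add_def split_beta mem_Times_iff)
      ultimately show ?thesis by (simp add: net_add_def split_beta)
    qed
    show "\<exists>k\<in>idx (net_add x y). le (net_add x y) i k \<and> le (net_add x y) j k"
      if ij: "i \<in> idx (net_add x y)" "j \<in> idx (net_add x y)" for i j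
    proof -
      have "fst i \<in> idx x" "fst j \<in> idx x" "snd i \<in> idx y" "snd j \<in> idx y"
        using ij by (auto simp: net_add_def)
      then obtain k l where "k \<in> idx x" "le x (fst i) k" "le x (fst j) k"
        "l \<in> idx y" "le y (snd i) l" "le y (snd j) l"
        using assms unfolding directed_net_def by metis
      then show ?thesis
        by (intro bexI[of _ "(k, l)"]) (auto simp: net_add_def split_beta)
    qed
  qed
  show "filterlim fst (tails x) (tails (net_add x y))"
    unfolding filterlim_iff
  proof (intro allI impI)
    fix P assume "eventually P (tails x)"
    then obtain k where k: "k \<in> idx x" "\<forall>i\<in>idx x. le x k i \<longrightarrow> P i"
      using assms by (auto simp: eventually_tails)
    obtain l where "l \<in> idx y" using assms by (auto simp: directed_net_def)
    then show "\<forall>\<^sub>F i in tails (net_add x y). P (fst i)"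
      unfolding eventually_tails[OF d] using k
      by (intro bexI[of _ "(k, l)"]) (auto simp: net_add_def)
  qed
  show "filterlim snd (tails y) (tails (net_add x y))"
    unfolding filterlim_iff
  proof (intro allI impI)
    fix P assume "eventually P (tails y)"
    then obtain k where k: "k \<in> idx y" "\<forall>i\<in>idx y. le y k i \<longrightarrow> P i"
      using assms by (auto simp: eventually_tails)
    obtain l where "l \<in> idx x" using assms by (auto simp: directed_net_def)
    then show "\<forall>\<^sub>F i in tails (net_add x y). P (snd i)"
      unfolding eventually_tails[OF d] using k
      by (intro bexI[of _ "(l, k)"]) (auto simp: net_add_def)
  qed
qed

context hilbert_bimodule
begin

lemma qs_cauchy_iff: "qs_cauchy lact ract x \<longleftrightarrow> (\<exists>q. qs_limit lact ract x q)"
proof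
  assume x: "qs_cauchy lact ract x"
  then have dir: "directed_net x" by (simp add: qs_cauchy_def)
  have "\<exists>v. ((\<lambda>i. ract (lact a (pt x i)) b) \<longlongrightarrow> v) (tails x)" for a b
  proof -
    let ?f = "\<lambda>i. ract (lact a (pt x i)) b"
    have "cauchy_filter (filtermap ?f (tails x))"
      unfolding cauchy_filter_metric_filtermap
    proof (intro allI impI)
      fix e :: real assume "0 < e"
      with x obtain k where k: "k \<in> idx x"
        "\<forall>i\<in>idx x. \<forall>j\<in>idx x. le x k i \<longrightarrow> le x k j \<longrightarrow> dist (?f i) (?f j) < e"
        unfolding qs_cauchy_def qs_seminorm_embed_diff by meson
      then show "\<exists>P. eventually P (tails x) \<and> (\<forall>i j. P i \<and> P j \<longrightarrow> dist (?f i) (?f j) < e)"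
        by (intro exI[of _ "\<lambda>i. i \<in> idx x \<and> le x k i"]) (auto simp: eventually_tails[OF dir])
    qed
    moreover have "filtermap ?f (tails x) \<noteq> bot"
      using tails_neq_bot[OF dir] by (simp add: filtermap_bot_iff)
    ultimately have "\<exists>v. filtermap ?f (tails x) \<le> nhds v"
      by (intro cauchy_filter_complete_converges[of _ UNIV]) (auto simp: complete_UNIV)
    then show ?thesis by (simp add: filterlim_def)
  qed
  then show "\<exists>q. qs_limit lact ract x q" unfolding qs_limit_def using dir by metis
next
  assume "\<exists>q. qs_limit lact ract x q"
  then obtain q where q: "qs_limit lact ract x q" ..
  show "qs_cauchy lact ract x"
    unfolding qs_cauchy_def qs_seminorm_embed_diff
  proof (intro conjI allI impI)
    show "directed_net x" using q by (simp add: qs_limit_def)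
    fix a b and e :: real assume "0 < e"
    then have "0 < e / 2" by simp
    with q obtain k where "k \<in> idx x"
      "\<forall>i\<in>idx x. le x k i \<longrightarrow> dist (ract (lact a (pt x i)) b) (q a b) < e / 2"
      unfolding qs_limit_iff by meson
    then show "\<exists>k\<in>idx x. \<forall>i\<in>idx x. \<forall>j\<in>idx x. le x k i \<longrightarrow> le x k j \<longrightarrow>
        dist (ract (lact a (pt x i)) b) (ract (lact a (pt x j)) b) < e"
      by (meson dist_triangle_half_l)
  qed
qed

lemma qs_equiv_iff:
  assumes x: "qs_limit lact ract x q" and y: "qs_limit lact ract y r"
  shows "qs_equiv lact ract x y \<longleftrightarrow> q = r"
proof
  assume eq: "qs_equiv lact ract x y"
  have "dist (q a b) (r a b) \<le> 0" for a b
  proof (rule field_le_epsilon)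
    let ?f = "\<lambda>v. ract (lact a v) b"
    fix e :: real assume "0 < e"
    then have e3: "0 < e / 3" by simp
    have dir: "directed_net x" "directed_net y" using x y by (simp_all add: qs_limit_def)
    obtain k l where kl: "k \<in> idx x" "l \<in> idx y"
      "\<forall>i\<in>idx x. \<forall>j\<in>idx y. le x k i \<longrightarrow> le y l j \<longrightarrow> dist (?f (pt x i)) (?f (pt y j)) < e / 3"
      using eq e3 unfolding qs_equiv_def qs_seminorm_embed_diff by meson
    obtain k' where k': "k' \<in> idx x" "\<forall>i\<in>idx x. le x k' i \<longrightarrow> dist (?f (pt x i)) (q a b) < e / 3"
      using x e3 unfolding qs_limit_iff by meson
    obtain l' where l': "l' \<in> idx y" "\<forall>j\<in>idx y. le y l' j \<longrightarrow> dist (?f (pt y j)) (r a b) < e / 3"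
      using y e3 unfolding qs_limit_iff by meson
    obtain i where i: "i \<in> idx x" "le x k i" "le x k' i"
      using dir kl k' unfolding directed_net_def by meson
    obtain j where j: "j \<in> idx y" "le y l j" "le y l' j"
      using dir kl l' unfolding directed_net_def by meson
    have "dist (?f (pt x i)) (?f (pt y j)) < e / 3" "dist (?f (pt x i)) (q a b) < e / 3"
      "dist (?f (pt y j)) (r a b) < e / 3"
      using kl k' l' i j by auto
    then show "dist (q a b) (r a b) \<le> 0 + e"
      using dist_triangle[of "q a b" "r a b" "?f (pt x i)"]
        dist_triangle[of "?f (pt x i)" "r a b" "?f (pt y j)"] by (simp add: dist_commute)
  qed
  then show "q = r" by (intro ext) simp
next
  assume "q = r"
  show "qs_equiv lact ract x y"
    unfolding qs_equiv_def qs_seminorm_embed_diff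
  proof (intro allI impI)
    fix a b and e :: real assume "0 < e"
    then have e2: "0 < e / 2" by simp
    obtain k where "k \<in> idx x"
      "\<forall>i\<in>idx x. le x k i \<longrightarrow> dist (ract (lact a (pt x i)) b) (q a b) < e / 2"
      using x e2 unfolding qs_limit_iff by meson
    moreover obtain l where "l \<in> idx y"
      "\<forall>j\<in>idx y. le y l j \<longrightarrow> dist (ract (lact a (pt y j)) b) (q a b) < e / 2"
      using y e2 unfolding qs_limit_iff \<open>q = r\<close> by meson
    ultimately show "\<exists>k\<in>idx x. \<exists>l\<in>idx y. \<forall>i\<in>idx x. \<forall>j\<in>idx y. le x k i \<longrightarrow> le y l j \<longrightarrow>
        dist (ract (lact a (pt x i)) b) (ract (lact a (pt y j)) b) < e"
      by (meson dist_triangle_half_l)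
  qed
qed

lemma qs_class_eq: "qs_limit lact ract x q \<Longrightarrow> qs_class lact ract x = qs_nets lact ract q"
  unfolding qs_class_def qs_nets_def using qs_cauchy_iff qs_equiv_iff by blast

text \<open>
  The algebraic identities pass to the limit; boundedness is then automatic.
\<close>

lemma qs_limit_in_QM:
  assumes x: "qs_limit lact ract x q"
  shows "q \<in> QM lact ract"
proof (rule QM_I)
  note lim = x[unfolded qs_limit_def, THEN conjunct2, rule_format]
  have "directed_net x" using x by (simp add: qs_limit_def)
  note uniq = tendsto_unique[OF tails_neq_bot[OF this]]
  show "q (a + c) b = q a b + q c b" for a c b
    using lim[of "a + c" b] tendsto_add[OF lim[of a b] lim[of c b]]
    by (intro uniq) (simp_all add: lact_add_left ract_add_left)
  show "q a (b + d) = q a b + q a d" for a b d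
    using lim[of a "b + d"] tendsto_add[OF lim[of a b] lim[of a d]]
    by (intro uniq) (simp_all add: ract_add_right)
  show "q (c *\<^sub>C a) b = c *\<^sub>C q a b" for c a b
    using lim[of "c *\<^sub>C a" b] bounded_linear.tendsto[OF bounded_linear_scaleC lim[of a b]]
    by (intro uniq) (simp_all add: lact_scaleC_left ract_scaleC_left)
  show "q a (c *\<^sub>C b) = c *\<^sub>C q a b" for c a b
    using lim[of a "c *\<^sub>C b"] bounded_linear.tendsto[OF bounded_linear_scaleC lim[of a b]]
    by (intro uniq) (simp_all add: ract_scaleC_right)
  show "q (c * a) (b * d) = ract (lact c (q a b)) d" for a c b d
    using lim[of "c * a" "b * d"]
      bounded_linear.tendsto[OF bounded_linear_ract
        bounded_linear.tendsto[OF bounded_linear_lact lim[of a b]], of c d]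
    by (intro uniq) (simp_all add: lact_mult ract_mult actions_commute)
qed

text \<open>
  The net consists of the points of the basic quasi-strict neighbourhoods of \<open>q\<close>, each point being indexed by
  itself together with the neighbourhood, ordered by reverse inclusion of the neighbourhoods. Density of \<open>V\<close>
  makes it directed.
\<close>

lemma QM_is_qs_limit:
  assumes q: "q \<in> QM lact ract"
  shows "qs_nets lact ract q \<noteq> {}"
proof -
  define N where "N F G e = {v. \<forall>a\<in>F. \<forall>b\<in>G. dist (ract (lact a v) b) (q a b) < e}" for F G e
  define I where "I = {(v, N F G e) | v F G e. finite F \<and> finite G \<and> 0 < e \<and> v \<in> N F G e}"
  define x :: "('v \<times> 'v set, 'v) net" where "x = Net I (\<lambda>i j. snd j \<subseteq> snd i) fst"
  have ex: "\<exists>v. (v, N F G e) \<in> I" if "finite F" "finite G" "0 < e" for F G e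
    using QM_approximated[OF q that] that unfolding I_def N_def by blast
  have "\<exists>k\<in>I. snd k \<subseteq> snd i \<and> snd k \<subseteq> snd j" if ij: "i \<in> I" "j \<in> I" for i j
  proof -
    obtain v F G e w F' G' e' where i: "i = (v, N F G e)" "finite F" "finite G" "0 < e"
      and j: "j = (w, N F' G' e')" "finite F'" "finite G'" "0 < e'"
      using ij unfolding I_def by auto
    obtain u where "(u, N (F \<union> F') (G \<union> G') (min e e')) \<in> I"
      using ex[of "F \<union> F'" "G \<union> G'" "min e e'"] i j by auto
    then show ?thesis
      by (rule bexI[rotated]) (auto simp: i j N_def)
  qed
  moreover have "I \<noteq> {}" using ex[of "{}" "{}" 1] by auto
  ultimately have dir: "directed_net x"
    unfolding directed_net_def x_def by auto
  have "qs_limit lact ract x q"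
    unfolding qs_limit_iff
  proof (intro conjI allI impI dir)
    fix a b and e :: real assume "0 < e"
    then obtain v where v: "(v, N {a} {b} e) \<in> I" using ex[of "{a}" "{b}" e] by auto
    have "dist (ract (lact a (fst i)) b) (q a b) < e" if "i \<in> I" "snd i \<subseteq> N {a} {b} e" for i
    proof -
      have "fst i \<in> snd i" using that(1) by (auto simp: I_def)
      then show ?thesis using that(2) by (auto simp: N_def)
    qed
    with v show "\<exists>k\<in>idx x. \<forall>i\<in>idx x. le x k i \<longrightarrow> dist (ract (lact a (pt x i)) b) (q a b) < e"
      by (intro bexI[of _ "(v, N {a} {b} e)"]) (auto simp: x_def)
  qed
  then show ?thesis by (auto simp: qs_nets_def)
qed

section \<open>The completion as the space of quasi-multipliers\<close>

text \<open>
  The computations below use this description: the completion is parametrized by the quasi-multipliers,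
  and each operation on classes becomes an operation on their common limits.
\<close>

lemma qs_completion_eq: "qs_completion lact ract = qs_nets lact ract ` QM lact ract"
proof
  show "qs_completion lact ract \<subseteq> qs_nets lact ract ` QM lact ract"
    unfolding qs_completion_def using qs_cauchy_iff qs_class_eq qs_limit_in_QM by blast
  show "qs_nets lact ract ` QM lact ract \<subseteq> qs_completion lact ract"
  proof safe
    fix q assume "q \<in> QM lact ract"
    then obtain x :: "('v \<times> 'v set, 'v) net" where "qs_limit lact ract x q"
      using QM_is_qs_limit by (auto simp: qs_nets_def)
    then show "qs_nets lact ract q \<in> qs_completion lact ract"
      unfolding qs_completion_def using qs_cauchy_iff qs_class_eq by blast
  qed
qed

lemma some_qs_net:
  assumes "q \<in> QM lact ract"
  shows "qs_limit lact ract (SOME x. x \<in> qs_nets lact ract q) q"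
  using QM_is_qs_limit[OF assms] some_in_eq[of "qs_nets lact ract q"] by (simp add: qs_nets_def)

lemma q_map_qs_nets: "q \<in> QM lact ract \<Longrightarrow> q_map lact ract (qs_nets lact ract q) = q"
  unfolding q_map_def by (rule q_lim_eq[OF some_qs_net])

lemma qsc_seminorm_qs_nets:
  assumes "q \<in> QM lact ract"
  shows "qsc_seminorm lact ract a b (qs_nets lact ract q) = norm (q a b)"
  using some_qs_net[OF assms] unfolding qsc_seminorm_def Let_def qs_seminorm_embed
  by (intro tendsto_Lim tails_neq_bot tendsto_norm) (auto simp: qs_limit_def)

lemma qs_limit_net_add:
  assumes "qs_limit lact ract x q" "qs_limit lact ract y r"
  shows "qs_limit lact ract (net_add x y) (\<lambda>a b. q a b + r a b)"
proof -
  have dir: "directed_net x" "directed_net y" using assms by (simp_all add: qs_limit_def)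
  have "((\<lambda>i. ract (lact a (pt x (fst i))) b + ract (lact a (pt y (snd i))) b) \<longlongrightarrow> q a b + r a b)
      (tails (net_add x y))" for a b
  proof (rule tendsto_add)
    have "((\<lambda>i. ract (lact a (pt x i)) b) \<longlongrightarrow> q a b) (tails x)"
      using assms(1) by (simp add: qs_limit_def)
    from filterlim_compose[OF this tails_net_add(2)[OF dir]]
    show "((\<lambda>i. ract (lact a (pt x (fst i))) b) \<longlongrightarrow> q a b) (tails (net_add x y))" .
    have "((\<lambda>i. ract (lact a (pt y i)) b) \<longlongrightarrow> r a b) (tails y)"
      using assms(2) by (simp add: qs_limit_def)
    from filterlim_compose[OF this tails_net_add(3)[OF dir]]
    show "((\<lambda>i. ract (lact a (pt y (snd i))) b) \<longlongrightarrow> r a b) (tails (net_add x y))" .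
  qed
  moreover have "pt (net_add x y) i = pt x (fst i) + pt y (snd i)" for i
    by (simp add: net_add_def split_beta)
  ultimately show ?thesis
    using tails_net_add(1)[OF dir] by (simp add: qs_limit_def lact_add_right ract_add_left)
qed

lemma qs_limit_net_scaleC:
  assumes "qs_limit lact ract x q"
  shows "qs_limit lact ract (net_scaleC c x) (\<lambda>a b. c *\<^sub>C q a b)"
  unfolding qs_limit_def
proof (intro conjI allI)
  have "directed_net (net_scaleC c x) \<longleftrightarrow> directed_net x"
    unfolding directed_net_def net_scaleC_def net.sel ..
  then show "directed_net (net_scaleC c x)" using assms by (simp add: qs_limit_def)
  have "((\<lambda>i. ract (lact a (pt x i)) b) \<longlongrightarrow> q a b) (tails x)" for a b
    using assms by (simp add: qs_limit_def)
  from bounded_linear.tendsto[OF bounded_linear_scaleC this]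
  show "((\<lambda>i. ract (lact a (pt (net_scaleC c x) i)) b) \<longlongrightarrow> c *\<^sub>C q a b) (tails (net_scaleC c x))"
    for a b
    by (simp add: net_scaleC_def tails_def lact_scaleC_right ract_scaleC_left)
qed

lemma qs_limit_net_const: "qs_limit lact ract (net_const v) (qm_embed lact ract v)"
  by (simp add: qs_limit_def net_const_def directed_net_def qm_embed_def)

lemma qsc_add_qs_nets:
  assumes "q \<in> QM lact ract" "r \<in> QM lact ract"
  shows "qsc_add lact ract (qs_nets lact ract q) (qs_nets lact ract r)
    = qs_nets lact ract (\<lambda>a b. q a b + r a b)"
proof -
  have "qs_class lact ract (net_add x y) = qs_nets lact ract (\<lambda>a b. q a b + r a b)"
    if "x \<in> qs_nets lact ract q" "y \<in> qs_nets lact ract r" for x y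
    using that qs_class_eq[OF qs_limit_net_add] by (simp add: qs_nets_def)
  then show ?thesis
    unfolding qsc_add_def using assms[THEN QM_is_qs_limit] by simp
qed

lemma qsc_scaleC_qs_nets:
  assumes "q \<in> QM lact ract"
  shows "qsc_scaleC lact ract c (qs_nets lact ract q) = qs_nets lact ract (\<lambda>a b. c *\<^sub>C q a b)"
proof -
  have "qs_class lact ract (net_scaleC c x) = qs_nets lact ract (\<lambda>a b. c *\<^sub>C q a b)"
    if "x \<in> qs_nets lact ract q" for x
    using that qs_class_eq[OF qs_limit_net_scaleC] by (simp add: qs_nets_def)
  then show ?thesis
    unfolding qsc_scaleC_def using QM_is_qs_limit[OF assms] by simp
qed

lemma QM_add:
  assumes "q \<in> QM lact ract" "r \<in> QM lact ract"
  shows "(\<lambda>a b. q a b + r a b) \<in> QM lact ract"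
  by (rule qs_limit_in_QM[OF qs_limit_net_add[OF assms[THEN some_qs_net]]])

lemma QM_scaleC: "q \<in> QM lact ract \<Longrightarrow> (\<lambda>a b. c *\<^sub>C q a b) \<in> QM lact ract"
  by (rule qs_limit_in_QM[OF qs_limit_net_scaleC[OF some_qs_net]])

end

theorem proposition2p17:
  fixes lact :: "'a::cstar_algebra \<Rightarrow> 'v::complex_banach \<Rightarrow> 'v"
    and linner :: "'v \<Rightarrow> 'v \<Rightarrow> 'a"
    and ract :: "'v \<Rightarrow> 'b::cstar_algebra \<Rightarrow> 'v"
    and rinner :: "'v \<Rightarrow> 'v \<Rightarrow> 'b"
  assumes "hilbert_bimodule lact linner ract rinner"
  shows "(\<forall>x :: ('i, 'v) net. qs_cauchy lact ract x \<longrightarrow>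
      (\<forall>a b. \<exists>v. ((\<lambda>i. ract (lact a (pt x i)) b) \<longlongrightarrow> v) (tails x))
      \<and> qs_class lact ract x \<in> qs_completion lact ract
      \<and> q_map lact ract (qs_class lact ract x) = q_lim lact ract x)
    \<and> (\<forall>\<xi>\<in>qs_completion lact ract. \<forall>\<eta>\<in>qs_completion lact ract.
      qsc_add lact ract \<xi> \<eta> \<in> qs_completion lact ract
      \<and> q_map lact ract (qsc_add lact ract \<xi> \<eta>)
          = (\<lambda>a b. q_map lact ract \<xi> a b + q_map lact ract \<eta> a b))
    \<and> (\<forall>c. \<forall>\<xi>\<in>qs_completion lact ract.
      qsc_scaleC lact ract c \<xi> \<in> qs_completion lact ract
      \<and> q_map lact ract (qsc_scaleC lact ract c \<xi>) = (\<lambda>a b. c *\<^sub>C q_map lact ract \<xi> a b))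
    \<and> (\<forall>\<xi>\<in>qs_completion lact ract. qm_norm (q_map lact ract \<xi>) = qsc_norm lact ract \<xi>)
    \<and> (bij_betw (q_map lact ract) (qs_completion lact ract) (QM lact ract))
    \<and> (\<forall>\<xi>\<in>qs_completion lact ract. \<forall>a b.
      qs_seminorm a b (q_map lact ract \<xi>) = qsc_seminorm lact ract a b \<xi>)
    \<and> (\<forall>v. q_map lact ract (qs_class lact ract (net_const v)) = qm_embed lact ract v)"
proof -
  interpret hilbert_bimodule lact linner ract rinner by fact
  have "(\<forall>a b. \<exists>v. ((\<lambda>i. ract (lact a (pt x i)) b) \<longlongrightarrow> v) (tails x))
      \<and> qs_class lact ract x \<in> qs_completion lact ract
      \<and> q_map lact ract (qs_class lact ract x) = q_lim lact ract x"
    if cauchy: "qs_cauchy lact ract x" for x :: "('i, 'v) net"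
  proof -
    obtain q where q: "qs_limit lact ract x q" using cauchy qs_cauchy_iff by blast
    then have "q \<in> QM lact ract" by (rule qs_limit_in_QM)
    with q show ?thesis
      by (auto simp: qs_class_eq[OF q] q_lim_eq[OF q] q_map_qs_nets qs_completion_eq qs_limit_def)
  qed
  moreover have "bij_betw (q_map lact ract) (qs_completion lact ract) (QM lact ract)"
    unfolding qs_completion_eq
    by (rule bij_betw_byWitness[where f' = "qs_nets lact ract"]) (auto simp: q_map_qs_nets)
  moreover have "q_map lact ract (qs_class lact ract (net_const v)) = qm_embed lact ract v" for v
    by (simp only: qs_class_eq[OF qs_limit_net_const] q_map_qs_nets[OF qm_embed_in_QM])
  ultimately show ?thesis
    unfolding qs_completion_eq
    by (intro conjI) (auto simp: qsc_add_qs_nets qsc_scaleC_qs_nets q_map_qs_nets QM_add QM_scaleC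
      qsc_seminorm_qs_nets qs_seminorm_QM qsc_norm_def qm_norm_def)
qed

end
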